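(* Let $\mathcal L$ be a $k$-local Lindblad generator on $n$ qubits with $\chi$-coefficients $\chi_{\mathbf P,\mathbf Q}$. Fix a decision threshold $\lambda>0$ and a margin $0<\gamma<\lambda$, and set $$\Omega_-:=\Omega_{\lambda-\gamma},\quad\Omega_+:=\Omega_{\lambda+\gamma},\quad\mathfrak d_-:=\mathfrak d_{\Omega_-},\quad D_-:=\sum_{\ell=0}^k\mathfrak d_-^\ell,\quad\rho_+:=\rho_{\Omega_+}.$$ Assume access to $\varepsilon_L$-accurate PTM estimates, $$\Bigl|\widehat L_{\mathbf A_S\otimes I_{\overline S},\mathbf B_S\otimes I_{\overline S}}-L_{\mathbf A_S\otimes I_{\overline S},\mathbf B_S\otimes I_{\overline S}}\Bigr|\le\varepsilon_L$$ for every nonempty $S\subseteq[n]$, $|S|\le k$, and all $\mathbf A_S,\mathbf B_S\in\mathcal P_S$, and suppose $D_-(\varepsilon_L+\rho_+)\le\gamma$. Then the guarded sparse recovery algorithm, run with decision threshold $\lambda$, outputs $\widehat\Omega_\lambda$ satisfying $$\Omega_+\subseteq\widehat\Omega_\lambda\subseteq\Omega_- .$$ Equivalently, for $(\mathbf P,\mathbf Q)\in\mathcal I_k^\circ$, $|\chi_{\mathbf P,\mathbf Q}|>\lambda+\gamma$ implies $(\mathbf P,\mathbf Q)\in\widehat\Omega_\lambda$, and $|\chi_{\mathbf P,\mathbf Q}|\le\lambda-\gamma$ implies $(\mathbf P,\mathbf Q)\notin\widehat\Omega_\lambda$. Moreover, every accepted coefficient estimate satisfies $|\widehat\chi_{\mathbf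 P,\mathbf Q}-\chi_{\mathbf P,\mathbf Q}|\le\gamma$. Finally, the exhaustive implementation of the algorithm has runtime $\mathcal O_k(n^k+2^k|\widehat\Omega_\lambda|)=\mathcal O_k(n^k)$.
   Context: Pauli notation. $\mathcal P_n=\{I,X,Y,Z\}^{\otimes n}$; $\operatorname{supp}(\mathbf P)$ is the set of qubits of nontrivial action, $\operatorname{wt}$ its size. For $S\subseteq[n]$, $\overline S=[n]\setminus S$, $\mathcal P_S$ is the set of Pauli strings on $S$, $\mathbf P_S$ the restriction of $\mathbf P$ to $S$. $X\bullet Y$ denotes $M\mapsto XMY$. A $k$-local Lindblad generator is $\mathcal L=-i[H,\bullet]+\sum_{e\subseteq[n],|e|\le k}\sum_{a}\bigl(L_{e,a}\bullet L_{e,a}^\dagger-\tfrac12\{L_{e,a}^\dagger L_{e,a},\bullet\}\bigr)$ on $\mathbb M_{2^n}$, with $H$ Hermitian, traceless, a combination of Pauli strings of weight $\le k$, and $L_{e,a}$ traceless supported on $e$. PTM entries: $L_{\mathbf P,\mathbf Q}=2^{-n}\operatorname{Tr}(\mathbf P\mathcal L(\mathbf Q))$. $\chi$-coefficients: $\mathcal L=\sum_{\mathbf P,\mathbf Q}\chi_{\mathbf P,\mathbf Q}\mathbf P\bullet\mathbf Q$; they vanish outside $\mathcal I_k$. $\mathcal I_k=\{(\mathbf P,\mathbf Q):|\operatorname{supp}(\mathbf P)\cup\operatorname{supp}(\mathbf Q)|\le k\}$, $\mathcal I_k^\circ=\mathcal I_k\setminus\{(I,I)\}$; for $\tau>0$,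 $\Omega_\tau=\{(\mathbf P,\mathbf Q)\in\mathcal I_k^\circ:|\chi_{\mathbf P,\mathbf Q}|>\tau\}$. For $\Omega\subseteq\mathcal I_k^\circ$: $\mathfrak d_\Omega$ is the maximum over $S\subseteq[n]$, $\mathbf P_S,\mathbf Q_S\in\mathcal P_S$ of the number of $\mathbf A\in\mathcal P_{\overline S}\setminus\{I\}$ with $(\mathbf P_S\otimes\mathbf A,\mathbf Q_S\otimes\mathbf A)\in\Omega$; $\rho_\Omega$ is the maximum over $S,\mathbf P_S,\mathbf Q_S$ of $\sum|\chi_{\mathbf P_S\otimes\mathbf A,\mathbf Q_S\otimes\mathbf A}|$ over $\mathbf A\in\mathcal P_{\overline S}\setminus\{I\}$ with $(\mathbf P_S\otimes\mathbf A,\mathbf Q_S\otimes\mathbf A)\notin\Omega$. Guarded sparse recovery algorithm (threshold $\lambda$). For all nonempty $S$, $|S|\le k$, and $\mathbf P_S,\mathbf Q_S\in\mathcal P_S$, compute $\widehat\chi^{(S)}_{\mathbf P_S,\mathbf Q_S}=2^{-3|S|}\sum_{\mathbf A_S,\mathbf B_S\in\mathcal P_S}\widehat L_{\mathbf A_S\otimes I_{\overline S},\mathbf B_S\otimes I_{\overline S}}\operatorname{Tr}(\mathbf A_S\mathbf Q_S\mathbf B_S\mathbf P_S)$. Set $\widehat\Omega_\lambda=\varnothing$ and all registers $\mathsf R(S,\mathbf P_S,\mathbf Q_S)=0$. For $s=k,k-1,\dots,1$ and every $(\mathbf P,\mathbf Q)\in\mathcal I_k$ whose support union $S=\operatorname{supp}(\mathbf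 P)\cup\operatorname{supp}(\mathbf Q)$ has size $s$: set $\widetilde\chi_{\mathbf P,\mathbf Q}=\widehat\chi^{(S)}_{\mathbf P_S,\mathbf Q_S}-\mathsf R(S,\mathbf P_S,\mathbf Q_S)$; if $|\widetilde\chi_{\mathbf P,\mathbf Q}|>\lambda$, add $(\mathbf P,\mathbf Q)$ to $\widehat\Omega_\lambda$ ("accept"), set $\widehat\chi_{\mathbf P,\mathbf Q}=\widetilde\chi_{\mathbf P,\mathbf Q}$, and for every $\varnothing\ne T\subsetneq S$ with $\mathbf P_{S\setminus T}=\mathbf Q_{S\setminus T}$ add $\widehat\chi_{\mathbf P,\mathbf Q}$ to $\mathsf R(T,\mathbf P_T,\mathbf Q_T)$. Return $\widehat\Omega_\lambda$ and the accepted estimates. *)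

theory Defs
  imports
    "Jordan_Normal_Form.Schur_Decomposition"
    "HOL-Library.Monad_Syntax"
begin

section \<open>Pauli strings\<close>

datatype pauli = PI | PX | PY | PZ

fun pauli1 :: "pauli \<Rightarrow> complex mat" where
  "pauli1 PI = 1\<^sub>m 2"
| "pauli1 PX = mat_of_rows_list 2 [[0, 1], [1, 0]]"
| "pauli1 PY = mat_of_rows_list 2 [[0, - \<i>], [\<i>, 0]]"
| "pauli1 PZ = mat_of_rows_list 2 [[1, 0], [0, - 1]]"

text \<open>The qubits of an \<open>n\<close>-qubit system are \<open>0, \<dots>, n - 1\<close>. A Pauli string on a set \<open>S\<close> of qubits
  is stored as a total function that is \<^const>\<open>PI\<close> outside \<open>S\<close>. With this convention a string
  \<open>P\<^sub>S\<close> and its padding \<open>P\<^sub>S \<otimes> I\<close> by identities are the same object.\<close>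

type_synonym pstring = "nat \<Rightarrow> pauli"

definition supp :: "pstring \<Rightarrow> nat set" where
  "supp P = {q. P q \<noteq> PI}"

definition wt :: "pstring \<Rightarrow> nat" where
  "wt P = card (supp P)"

definition strings :: "nat set \<Rightarrow> pstring set" where
  "strings S = {P. supp P \<subseteq> S}"

definition id_str :: pstring where
  "id_str = (\<lambda>_. PI)"

definition restr :: "nat set \<Rightarrow> pstring \<Rightarrow> pstring" where
  "restr S P = (\<lambda>q. if q \<in> S then P q else PI)"

text \<open>\<open>tensor S P A\<close> is \<open>P \<otimes> A\<close> for \<open>P\<close> on \<open>S\<close> and \<open>A\<close> on the complement of \<open>S\<close>.\<close>

definition tensor :: "nat set \<Rightarrow> pstring \<Rightarrow> pstring \<Rightarrow> pstring" where
  "tensor S P A = (\<lambda>q. if q \<in> S then P q else A q)"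


section \<open>Matrices and superoperators\<close>

text \<open>\<open>pauli_mat qs P\<close> is the tensor product of the matrices \<open>pauli1 (P q)\<close>, \<open>q \<in> set qs\<close>, written
  out entrywise: the binary digits of a row or column index are the computational basis states of
  the qubits, digit \<open>r\<close> belonging to the qubit \<open>qs ! r\<close>.\<close>

definition pauli_mat :: "nat list \<Rightarrow> pstring \<Rightarrow> complex mat" where
  "pauli_mat qs P = mat (2 ^ length qs) (2 ^ length qs)
     (\<lambda>(i, j). \<Prod>r<length qs. pauli1 (P (qs ! r)) $$ (of_bool (bit i r), of_bool (bit j r)))"

abbreviation pmat :: "nat \<Rightarrow> pstring \<Rightarrow> complex mat" where
  "pmat n P \<equiv> pauli_mat [0..<n] P"

abbreviation pmat_on :: "nat set \<Rightarrow> pstring \<Rightarrow> complex mat" where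
  "pmat_on S P \<equiv> pauli_mat (sorted_list_of_set S) P"

abbreviation ops :: "nat \<Rightarrow> complex mat set" where
  "ops n \<equiv> carrier_mat (2 ^ n) (2 ^ n)"

definition mtrace :: "complex mat \<Rightarrow> complex" where
  "mtrace M = (\<Sum>i<dim_row M. M $$ (i, i))"

definition msum :: "nat \<Rightarrow> 'a set \<Rightarrow> ('a \<Rightarrow> complex mat) \<Rightarrow> complex mat" where
  "msum n A f = mat (2 ^ n) (2 ^ n) (\<lambda>(i, j). \<Sum>x\<in>A. f x $$ (i, j))"

text \<open>\<open>M = M\<^sub>e \<otimes> I\<close>, where \<open>f\<close> lists the entries of \<open>M\<^sub>e\<close>; a basis state of the qubits in \<open>e\<close> is
  given by the set of qubits that are in state 1.\<close>

definition supported_on :: "nat \<Rightarrow> nat set \<Rightarrow> complex mat \<Rightarrow> bool" where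
  "supported_on n e M \<longleftrightarrow>
     (\<exists>f :: nat set \<Rightarrow> nat set \<Rightarrow> complex. \<forall>i<2 ^ n. \<forall>j<2 ^ n.
        M $$ (i, j) =
          (if \<forall>q\<in>{..<n} - e. bit i q = bit j q
           then f {q \<in> e. bit i q} {q \<in> e. bit j q} else 0))"

text \<open>Superoperators are only considered on \<^term>\<open>ops n\<close>. The jump operators attached to \<open>e\<close> are
  \<open>J e a\<close> for \<open>a < m e\<close>.\<close>

definition k_local_lindblad :: "nat \<Rightarrow> nat \<Rightarrow> (complex mat \<Rightarrow> complex mat) \<Rightarrow> bool" where
  "k_local_lindblad n k L \<longleftrightarrow>
     (\<exists>(H :: complex mat) (h :: pstring \<Rightarrow> complex)
       (m :: nat set \<Rightarrow> nat) (J :: nat set \<Rightarrow> nat \<Rightarrow> complex mat).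
        H \<in> ops n \<and> mat_adjoint H = H \<and> mtrace H = 0 \<and>
        H = msum n {P \<in> strings {..<n}. wt P \<le> k} (\<lambda>P. h P \<cdot>\<^sub>m pmat n P) \<and>
        (\<forall>e a. e \<subseteq> {..<n} \<and> card e \<le> k \<and> a < m e \<longrightarrow>
           J e a \<in> ops n \<and> mtrace (J e a) = 0 \<and> supported_on n e (J e a)) \<and>
        (\<forall>M\<in>ops n. L M =
           (- \<i>) \<cdot>\<^sub>m (H * M - M * H) +
           msum n (SIGMA e:{e. e \<subseteq> {..<n} \<and> card e \<le> k}. {..<m e})
             (\<lambda>(e, a). J e a * M * mat_adjoint (J e a) -
                (1 / 2) \<cdot>\<^sub>m (mat_adjoint (J e a) * J e a * M + M * (mat_adjoint (J e a) * J e a)))))"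

definition ptm :: "nat \<Rightarrow> (complex mat \<Rightarrow> complex mat) \<Rightarrow> pstring \<Rightarrow> pstring \<Rightarrow> complex" where
  "ptm n L P Q = mtrace (pmat n P * L (pmat n Q)) / 2 ^ n"

definition chi_coeffs ::
    "nat \<Rightarrow> (complex mat \<Rightarrow> complex mat) \<Rightarrow> (pstring \<Rightarrow> pstring \<Rightarrow> complex) \<Rightarrow> bool" where
  "chi_coeffs n L chi \<longleftrightarrow>
     (\<forall>M\<in>ops n. L M =
        msum n (strings {..<n} \<times> strings {..<n}) (\<lambda>(P, Q). chi P Q \<cdot>\<^sub>m (pmat n P * M * pmat n Q)))"


section \<open>Local index sets and their parameters\<close>

definition supp2 :: "pstring \<times> pstring \<Rightarrow> nat set" where
  "supp2 = (\<lambda>(P, Q). supp P \<union> supp Q)"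

definition local_pairs :: "nat \<Rightarrow> nat \<Rightarrow> (pstring \<times> pstring) set" where
  "local_pairs n k = {pq \<in> strings {..<n} \<times> strings {..<n}. card (supp2 pq) \<le> k}"

definition local_pairs0 :: "nat \<Rightarrow> nat \<Rightarrow> (pstring \<times> pstring) set" where
  "local_pairs0 n k = local_pairs n k - {(id_str, id_str)}"

definition Omega ::
    "nat \<Rightarrow> nat \<Rightarrow> (pstring \<Rightarrow> pstring \<Rightarrow> complex) \<Rightarrow> real \<Rightarrow> (pstring \<times> pstring) set" where
  "Omega n k chi \<tau> = {(P, Q) \<in> local_pairs0 n k. cmod (chi P Q) > \<tau>}"

definition ddeg :: "nat \<Rightarrow> (pstring \<times> pstring) set \<Rightarrow> nat" where
  "ddeg n \<Omega> = Max {card {A \<in> strings ({..<n} - S) - {id_str}. (tensor S P A, tensor S Q A) \<in> \<Omega>} | S P Q.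
                     S \<subseteq> {..<n} \<and> P \<in> strings S \<and> Q \<in> strings S}"

definition rho ::
    "nat \<Rightarrow> (pstring \<Rightarrow> pstring \<Rightarrow> complex) \<Rightarrow> (pstring \<times> pstring) set \<Rightarrow> real" where
  "rho n chi \<Omega> = Max {(\<Sum>A\<in>{A \<in> strings ({..<n} - S) - {id_str}. (tensor S P A, tensor S Q A) \<notin> \<Omega>}.
                          cmod (chi (tensor S P A) (tensor S Q A))) | S P Q.
                       S \<subseteq> {..<n} \<and> P \<in> strings S \<and> Q \<in> strings S}"


section \<open>Computations with a step count\<close>

text \<open>The programs below charge their elementary steps explicitly, in the unit-cost RAM model:
  an arithmetic operation or comparison of numbers, a query of the table of PTM estimates, and a
  step of a loop cost one unit each. A string on \<open>S\<close> is stored as \<open>card S\<close> pairs of a qubit and a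
  letter, sets of qubits as increasing lists; touching such an object, or a memory cell addressed
  by it, costs \<open>card S + 1\<close>.\<close>

datatype 'a timed = Timed (result: 'a) (cost: nat)

definition return :: "'a \<Rightarrow> 'a timed" where
  "return x = Timed x 0"

definition bind_timed :: "'a timed \<Rightarrow> ('a \<Rightarrow> 'b timed) \<Rightarrow> 'b timed" where
  "bind_timed c f = Timed (result (f (result c))) (cost c + cost (f (result c)))"

adhoc_overloading Monad_Syntax.bind \<rightleftharpoons> bind_timed

definition tick :: "nat \<Rightarrow> unit timed" where
  "tick t = Timed () t"

fun for_each :: "'a list \<Rightarrow> ('a \<Rightarrow> 's \<Rightarrow> 's timed) \<Rightarrow> 's \<Rightarrow> 's timed" where
  "for_each [] f s = do { tick 1; return s }"
| "for_each (x # xs) f s = do { tick 1; s' \<leftarrow> f x s; for_each xs f s' }"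

fun sized_subsets :: "nat \<Rightarrow> nat \<Rightarrow> nat set list timed" where
  "sized_subsets m 0 = do { tick 1; return [{}] }"
| "sized_subsets 0 (Suc s) = do { tick 1; return [] }"
| "sized_subsets (Suc m) (Suc s) = do {
     xs \<leftarrow> sized_subsets m s;
     ys \<leftarrow> sized_subsets m (Suc s);
     tick (1 + (s + 2) * length xs);
     return (map (insert m) xs @ ys) }"

fun all_subsets :: "nat list \<Rightarrow> nat set list timed" where
  "all_subsets [] = do { tick 1; return [{}] }"
| "all_subsets (q # qs) = do {
     xs \<leftarrow> all_subsets qs;
     tick (1 + 2 * (length qs + 2) * length xs);
     return (map (insert q) xs @ xs) }"

fun all_strings :: "nat list \<Rightarrow> pstring list timed" where
  "all_strings [] = do { tick 1; return [id_str] }"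
| "all_strings (q # qs) = do {
     Ps \<leftarrow> all_strings qs;
     tick (1 + 4 * (length qs + 2) * length Ps);
     return (concat (map (\<lambda>a. map (\<lambda>P. P(q := a)) Ps) [PI, PX, PY, PZ])) }"


section \<open>Guarded sparse recovery\<close>

text \<open>\<open>Lhat A B\<close> is the estimate of the PTM entry with row \<open>A\<close> and column \<open>B\<close>, padded by
  identities.\<close>

definition chi_hat ::
    "(pstring \<Rightarrow> pstring \<Rightarrow> complex) \<Rightarrow> nat set \<Rightarrow> pstring \<Rightarrow> pstring \<Rightarrow> complex" where
  "chi_hat Lhat S P Q =
     (\<Sum>A\<in>strings S. \<Sum>B\<in>strings S.
        Lhat A B * mtrace (pmat_on S A * pmat_on S Q * pmat_on S B * pmat_on S P)) / 2 ^ (3 * card S)"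

type_synonym key = "nat set \<times> pstring \<times> pstring"

record rec_state =
  accepted :: "(pstring \<times> pstring) set"
  estimate :: "pstring \<times> pstring \<Rightarrow> complex"
  register :: "key \<Rightarrow> complex"

text \<open>One iteration of the main loop, at the pair \<open>(P, Q)\<close>; the values \<^const>\<open>chi_hat\<close> are read from the
  memory \<open>tab\<close>.\<close>

definition visit ::
    "real \<Rightarrow> (key \<Rightarrow> complex) \<Rightarrow> pstring \<times> pstring \<Rightarrow> rec_state \<Rightarrow> rec_state timed" where
  "visit lam tab = (\<lambda>(P, Q) st. do {
     let S = supp P \<union> supp Q;
     let c = tab (S, restr S P, restr S Q) - register st (S, restr S P, restr S Q);
     tick (3 * (card S + 1) + 2);
     if cmod c > lam then do {
       tick (2 * (card S + 1));
       Ts \<leftarrow> all_subsets (sorted_list_of_set S);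
       for_each Ts
         (\<lambda>T st. do {
            tick (3 * (card S + 1));
            if T \<noteq> {} \<and> T \<subset> S \<and> restr (S - T) P = restr (S - T) Q then do {
              let r = (T, restr T P, restr T Q);
              tick (3 * (card S + 1) + 1);
              return (st\<lparr>register := (register st)(r := register st r + c)\<rparr>)
            } else return st })
         (st\<lparr>accepted := insert (P, Q) (accepted st), estimate := (estimate st)((P, Q) := c)\<rparr>)
     } else return st })"

definition sweep ::
    "real \<Rightarrow> (key \<Rightarrow> complex) \<Rightarrow> (pstring \<times> pstring) list \<Rightarrow> rec_state \<Rightarrow> rec_state timed" where
  "sweep lam tab xs st = for_each xs (visit lam tab) st"

text \<open>The algorithm leaves open in which order the pairs with the same size of the support union are
  visited. Pairs are visited by decreasing size, from \<open>k\<close> down to \<open>1\<close>.\<close>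

definition visit_order :: "nat \<Rightarrow> nat \<Rightarrow> (pstring \<times> pstring) list \<Rightarrow> bool" where
  "visit_order n k xs \<longleftrightarrow>
     distinct xs \<and> set xs = {pq \<in> local_pairs n k. 1 \<le> card (supp2 pq)} \<and>
     sorted_wrt (\<lambda>x y. card (supp2 x) \<ge> card (supp2 y)) xs"

definition guarded_recovery ::
    "real \<Rightarrow> (pstring \<Rightarrow> pstring \<Rightarrow> complex) \<Rightarrow> (pstring \<times> pstring) list \<Rightarrow> rec_state" where
  "guarded_recovery lam Lhat xs =
     result (sweep lam (\<lambda>(S, P, Q). chi_hat Lhat S P Q) xs
       \<lparr>accepted = {}, estimate = (\<lambda>_. 0), register = (\<lambda>_. 0)\<rparr>)"


section \<open>The exhaustive implementation\<close>

text \<open>Charge for the naive evaluation of the trace of a product of four Pauli strings on \<open>s\<close> qubits: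
  writing down four matrices of order \<open>2 ^ s\<close>, three matrix products, the diagonal sum.\<close>

definition trace_cost :: "nat \<Rightarrow> nat" where
  "trace_cost s = 4 * (s + 1) * 4 ^ s + 3 * (2 * 8 ^ s) + 2 ^ s"

definition chi_hat_timed ::
    "(pstring \<Rightarrow> pstring \<Rightarrow> complex) \<Rightarrow> nat set \<Rightarrow> pstring \<Rightarrow> pstring \<Rightarrow> complex timed" where
  "chi_hat_timed Lhat S P Q = do {
     Ps \<leftarrow> all_strings (sorted_list_of_set S);
     x \<leftarrow> for_each Ps (\<lambda>A. for_each Ps (\<lambda>B x. do {
            tick (2 * (card S + 1) + trace_cost (card S) + 3);
            return (x + Lhat A B *
              mtrace (pmat_on S A * pmat_on S Q * pmat_on S B * pmat_on S P)) })) 0;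
     tick (3 * card S + 1);
     return (x / 2 ^ (3 * card S)) }"

text \<open>Computes the table of all local estimates, and clears the registers.\<close>

definition prepare ::
    "nat \<Rightarrow> nat \<Rightarrow> (pstring \<Rightarrow> pstring \<Rightarrow> complex) \<Rightarrow> ((key \<Rightarrow> complex) \<times> (key \<Rightarrow> complex)) timed" where
  "prepare n k Lhat =
     for_each [1..<Suc k] (\<lambda>s mem. do {
       Ss \<leftarrow> sized_subsets n s;
       for_each Ss (\<lambda>S mem. do {
         Ps \<leftarrow> all_strings (sorted_list_of_set S);
         for_each Ps (\<lambda>P. for_each Ps (\<lambda>Q (tab, reg). do {
           c \<leftarrow> chi_hat_timed Lhat S P Q;
           tick (6 * (card S + 1));
           return (tab((S, P, Q) := c), reg((S, P, Q) := 0)) })) mem }) mem })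
     (\<lambda>_. undefined, \<lambda>_. undefined)"

definition level_pairs :: "nat \<Rightarrow> nat \<Rightarrow> (pstring \<times> pstring) list timed" where
  "level_pairs n s = do {
     Ss \<leftarrow> sized_subsets n s;
     for_each Ss (\<lambda>S xs. do {
       Ps \<leftarrow> all_strings (sorted_list_of_set S);
       for_each Ps (\<lambda>P. for_each Ps (\<lambda>Q xs. do {
         tick (3 * (card S + 1));
         return (if supp P \<union> supp Q = S then (P, Q) # xs else xs) })) xs }) [] }"

definition exhaustive_recovery ::
    "nat \<Rightarrow> nat \<Rightarrow> real \<Rightarrow> (pstring \<Rightarrow> pstring \<Rightarrow> complex) \<Rightarrow> rec_state timed" where
  "exhaustive_recovery n k lam Lhat = do {
     (tab, reg) \<leftarrow> prepare n k Lhat;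
     for_each (rev [1..<Suc k])
       (\<lambda>s st. do { xs \<leftarrow> level_pairs n s; sweep lam tab xs st })
       \<lparr>accepted = {}, estimate = (\<lambda>_. 0), register = reg\<rparr> }"

end

theory Submission
  imports Defs
begin

text \<open>The trace of a product of four Pauli strings factorizes over the qubits, so the single-qubit
  relation \<open>\<Sum>\<^sub>a\<^sub>b tr(a p' b q') tr(a q b p) = 16 \<delta>\<^sub>p\<^sub>p\<^sub>' \<delta>\<^sub>q\<^sub>q\<^sub>'\<close> shows that on exact PTM entries the local estimate
  of \<open>(P, Q)\<close> on \<open>S\<close> is \<open>\<Sum>\<^sub>A \<chi>(P \<otimes> A, Q \<otimes> A)\<close>, \<open>A\<close> ranging over the strings off \<open>S\<close>; and
  \<open>\<Sum>\<^sub>a\<^sub>b |tr(a q b p)| = 8\<close> shows that errors \<open>\<epsilon>\<close> of the PTM entries change it by at most \<open>\<epsilon>\<close>.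

  When \<open>(P, Q)\<close> with support union \<open>S\<close> is visited, its register holds the sum of the accepted
  estimates of the pairs \<open>(P \<otimes> A, Q \<otimes> A)\<close> with \<open>A \<noteq> I\<close>, which all have larger support. By induction
  the accepted ones lie in \<open>\<Omega>\<^sub>-\<close>, so there are at most \<open>d\<close> of them, and the others lie outside \<open>\<Omega>\<^sub>+\<close>, so
  they contribute at most \<open>\<rho>\<close>. Hence the error bound \<open>e\<^sub>s\<close> at size \<open>s\<close> satisfies
  \<open>e\<^sub>s = \<epsilon> + \<rho> + d e\<^sub>s\<^sub>+\<^sub>1\<close>, that is \<open>e\<^sub>s = (\<epsilon> + \<rho>) (1 + d + \<dots> + d\<^bsup>k-s\<^esup>) \<le> \<gamma>\<close>, and a decision with threshold
  \<open>lam\<close> on a value with error at most \<open>\<gamma>\<close> is correct outside the window.\<close>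

section \<open>Traces of products of Pauli strings\<close>

lemma UNIV_pauli: "UNIV = {PI, PX, PY, PZ}"
  by (auto intro: pauli.exhaust)

instance pauli :: finite
  by standard (simp add: UNIV_pauli)

lemma sum_pauli: "(\<Sum>a\<in>UNIV. f a) = f PI + f PX + f PY + f PZ"
  for f :: "pauli \<Rightarrow> 'a::comm_monoid_add"
  by (simp add: UNIV_pauli add.assoc)

text \<open>Boolean indices match the results of \<open>bit\<close>, so a sum over the basis states
  of one qubit is a sum over \<open>UNIV\<close>.\<close>

definition entry :: "pauli \<Rightarrow> bool \<Rightarrow> bool \<Rightarrow> complex" where
  "entry a x y = pauli1 a $$ (of_bool x, of_bool y)"

lemma entry_simps:
  "entry PI x y = (if x = y then 1 else 0)"
  "entry PX x y = (if x = y then 0 else 1)"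
  "entry PY x y = (if x = y then 0 else if x then \<i> else - \<i>)"
  "entry PZ x y = (if x = y then (if x then - 1 else 1) else 0)"
  by (auto simp: entry_def mat_of_rows_list_def)

text \<open>The product of letters up to phase, a Klein four-group; \<open>pauli_phase\<close>
  restores the phase.\<close>

fun pauli_mul :: "pauli \<Rightarrow> pauli \<Rightarrow> pauli" where
  "pauli_mul PI b = b"
| "pauli_mul a PI = a"
| "pauli_mul PX PY = PZ" | "pauli_mul PY PX = PZ"
| "pauli_mul PX PZ = PY" | "pauli_mul PZ PX = PY"
| "pauli_mul PY PZ = PX" | "pauli_mul PZ PY = PX"
| "pauli_mul PX PX = PI" | "pauli_mul PY PY = PI" | "pauli_mul PZ PZ = PI"

fun pauli_phase :: "pauli \<Rightarrow> pauli \<Rightarrow> complex" where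
  "pauli_phase PX PY = \<i>" | "pauli_phase PY PX = - \<i>"
| "pauli_phase PX PZ = - \<i>" | "pauli_phase PZ PX = \<i>"
| "pauli_phase PY PZ = \<i>" | "pauli_phase PZ PY = - \<i>"
| "pauli_phase _ _ = 1"

lemma entry_mul:
  "(\<Sum>y\<in>UNIV. entry a x y * entry b y z) = pauli_phase a b * entry (pauli_mul a b) x z"
  by (cases a; cases b; cases x; cases z) (simp_all add: entry_simps UNIV_bool)

lemma entry_orthogonal:
  "(\<Sum>x\<in>UNIV. \<Sum>y\<in>UNIV. entry a x y * entry b y x) = (if a = b then 2 else 0)"
  by (cases a; cases b) (simp_all add: entry_simps UNIV_bool)

text \<open>The trace of the matrix product \<open>a b c d\<close>: two Pauli matrices multiply to a phase times a Pauli
  matrix, and distinct Pauli matrices are orthogonal.\<close>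

definition pauli_tr :: "pauli \<Rightarrow> pauli \<Rightarrow> pauli \<Rightarrow> pauli \<Rightarrow> complex" where
  "pauli_tr a b c d =
     (if pauli_mul a b = pauli_mul c d then 2 * pauli_phase a b * pauli_phase c d else 0)"

text \<open>Completeness in \<open>b\<close> merges the two traces into 2 tr(q' a p' p a q), and
  summing a p' p a over \<open>a\<close> gives 2 tr(p' p) times the identity; orthogonality then
  leaves 16 or 0. The proof simply checks the 256 cases.\<close>

lemma pauli_tr_completeness:
  "(\<Sum>a\<in>UNIV. \<Sum>b\<in>UNIV. pauli_tr a p' b q' * pauli_tr a q b p) =
     (if p' = p \<and> q' = q then 16 else 0)"
  by (cases p; cases q; cases p'; cases q'; simp add: sum_pauli pauli_tr_def)

text \<open>For each of the four \<open>a\<close> exactly one \<open>b\<close> gives a nonzero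
  trace, and that trace has modulus 2.\<close>

lemma sum_norm_pauli_tr: "(\<Sum>a\<in>UNIV. \<Sum>b\<in>UNIV. cmod (pauli_tr a q b p)) = 8"
  by (cases p; cases q) (simp_all add: sum_pauli pauli_tr_def norm_mult)

lemma pauli_tr_PI: "pauli_tr PI p PI q = (if p = q then 2 else 0)"
  by (simp add: pauli_tr_def)

section \<open>Tensor products indexed by binary digits\<close>

definition tens :: "nat \<Rightarrow> (nat \<Rightarrow> bool \<Rightarrow> bool \<Rightarrow> complex) \<Rightarrow> complex mat" where
  "tens l m = mat (2 ^ l) (2 ^ l) (\<lambda>(i, j). \<Prod>r<l. m r (bit i r) (bit j r))"

lemma pauli_mat_tens: "pauli_mat qs P = tens (length qs) (\<lambda>r. entry (P (qs ! r)))"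
  by (simp add: pauli_mat_def tens_def entry_def)

lemma tens_carrier [simp]: "tens l m \<in> carrier_mat (2 ^ l) (2 ^ l)"
  by (simp add: tens_def)

lemma pauli_mat_carrier [simp]: "pauli_mat qs P \<in> carrier_mat (2 ^ length qs) (2 ^ length qs)"
  by (simp add: pauli_mat_tens)

lemma pmat_carrier [simp]: "pmat n P \<in> ops n"
  using pauli_mat_carrier[of "[0..<n]" P] by simp

lemma sum_lessThan_double: "(\<Sum>j<2 * m. h j) = (\<Sum>j<m. h (2 * j) + h (Suc (2 * j)))"
  for h :: "nat \<Rightarrow> 'a::comm_monoid_add"
  by (induction m) (simp_all add: ac_simps)

text \<open>Numbers below \<open>2 ^ l\<close> enumerate the Boolean vectors of length
  \<open>l\<close>, so this is distributivity. The induction splits off bit 0, that is, even and odd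
  \<open>j\<close>; this shifts the factors, hence \<open>g\<close> is arbitrary.\<close>

lemma sum_prod_bits:
  fixes g :: "nat \<Rightarrow> bool \<Rightarrow> 'a::comm_semiring_1"
  shows "(\<Sum>j<2 ^ l. \<Prod>r<l. g r (bit (j::nat) r)) = (\<Prod>r<l. \<Sum>b\<in>UNIV. g r b)"
proof (induction l arbitrary: g)
  case (Suc l)
  have "(\<Sum>j<2 ^ Suc l. \<Prod>r<Suc l. g r (bit (j::nat) r)) =
      (\<Sum>j<2 ^ l. (g 0 False + g 0 True) * (\<Prod>r<l. g (Suc r) (bit (j::nat) r)))"
    by (simp add: sum_lessThan_double prod.lessThan_Suc_shift bit_Suc bit_0 distrib_right
        del: prod.lessThan_Suc)
  also have "\<dots> = (g 0 False + g 0 True) * (\<Prod>r<l. \<Sum>b\<in>UNIV. g (Suc r) b)"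
    by (simp only: sum_distrib_left[symmetric] Suc.IH[of "\<lambda>r. g (Suc r)"])
  finally show ?case
    by (simp add: prod.lessThan_Suc_shift UNIV_bool add.commute del: prod.lessThan_Suc)
qed simp

lemma tens_mult:
  "tens l m * tens l m' = tens l (\<lambda>r x z. \<Sum>y\<in>UNIV. m r x y * m' r y z)"
proof (rule eq_matI)
  fix i j
  assume "i < dim_row (tens l (\<lambda>r x z. \<Sum>y\<in>UNIV. m r x y * m' r y z))"
    and "j < dim_col (tens l (\<lambda>r x z. \<Sum>y\<in>UNIV. m r x y * m' r y z))"
  then have ij: "i < 2 ^ l" "j < 2 ^ l" by (simp_all add: tens_def)
  then have "(tens l m * tens l m') $$ (i, j) =
      (\<Sum>k<2 ^ l. \<Prod>r<l. m r (bit i r) (bit (k::nat) r) * m' r (bit k r) (bit j r))"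
    by (simp add: tens_def scalar_prod_def prod.distrib atLeast0LessThan)
  also have "\<dots> = (\<Prod>r<l. \<Sum>y\<in>UNIV. m r (bit i r) y * m' r y (bit j r))"
    by (rule sum_prod_bits)
  finally show "(tens l m * tens l m') $$ (i, j) =
      tens l (\<lambda>r x z. \<Sum>y\<in>UNIV. m r x y * m' r y z) $$ (i, j)"
    using ij by (simp add: tens_def)
qed (simp_all add: tens_def)

lemma mtrace_tens: "mtrace (tens l m) = (\<Prod>r<l. \<Sum>x\<in>UNIV. m r x x)"
  using sum_prod_bits[where l = l and g = "\<lambda>r x. m r x x"] by (simp add: mtrace_def tens_def)

text \<open>Bracketing as (A B) (C D) leaves two Pauli strings with phases, so that only
  orthogonality is needed on each qubit. Distinctness turns the product over positions into one over
  the set of qubits.\<close>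

lemma mtrace_pauli4:
  assumes "distinct qs"
  shows "mtrace (pauli_mat qs A * pauli_mat qs B * pauli_mat qs C * pauli_mat qs D) =
    (\<Prod>q\<in>set qs. pauli_tr (A q) (B q) (C q) (D q))"
proof -
  let ?l = "length qs"
  have assoc: "pauli_mat qs A * pauli_mat qs B * pauli_mat qs C * pauli_mat qs D =
     (pauli_mat qs A * pauli_mat qs B) * (pauli_mat qs C * pauli_mat qs D)"
    using assoc_mult_mat[OF mult_carrier_mat[OF pauli_mat_carrier pauli_mat_carrier]
        pauli_mat_carrier pauli_mat_carrier] .
  have tr: "(\<Sum>x\<in>UNIV. \<Sum>z\<in>UNIV. (u * entry a x z) * (v * entry b z x)) = (if a = b then 2 * u * v else 0)"
    for u v a b
  proof -
    have "(\<Sum>x\<in>UNIV. \<Sum>z\<in>UNIV. (u * entry a x z) * (v * entry b z x)) =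
      u * v * (\<Sum>x\<in>UNIV. \<Sum>z\<in>UNIV. entry a x z * entry b z x)"
      unfolding sum_distrib_left by (simp add: ac_simps)
    then show ?thesis by (simp add: entry_orthogonal)
  qed
  have "mtrace (pauli_mat qs A * pauli_mat qs B * pauli_mat qs C * pauli_mat qs D) =
    (\<Prod>r<?l. pauli_tr (A (qs ! r)) (B (qs ! r)) (C (qs ! r)) (D (qs ! r)))"
    unfolding assoc unfolding pauli_mat_tens tens_mult entry_mul mtrace_tens tr pauli_tr_def by (rule refl)
  also have "\<dots> = (\<Prod>q\<in>set qs. pauli_tr (A q) (B q) (C q) (D q))"
    by (rule prod.reindex_bij_betw) (use assms bij_betw_nth in blast)
  finally show ?thesis .
qed

section \<open>Sums over Pauli strings\<close>

lemma finite_strings: "finite S \<Longrightarrow> finite (strings S)"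
  unfolding strings_def supp_def
  by (rule finite_subset[OF _ finite_set_of_finite_funs[of S UNIV PI]]) auto

lemma strings_empty: "strings {} = {id_str}"
  by (auto simp: strings_def supp_def id_str_def)

lemma strings_insert:
  assumes "q \<notin> S"
  shows "bij_betw (\<lambda>(a, P). P(q := a)) (UNIV \<times> strings S) (strings (insert q S))"
proof (rule bij_betw_byWitness[where f' = "\<lambda>P. (P q, P(q := PI))"])
  have "P q = PI" if "P \<in> strings S" for P
    using that assms by (auto simp: strings_def supp_def)
  then have "P(q := PI) = P" if "P \<in> strings S" for P
    using that by (metis fun_upd_triv)
  then show "\<forall>x\<in>UNIV \<times> strings S. (\<lambda>P. (P q, P(q := PI))) ((\<lambda>(a, P). P(q := a)) x) = x"
    by auto
  show "(\<lambda>(a, P). P(q := a)) ` (UNIV \<times> strings S) \<subseteq> strings (insert q S)"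
    by (auto simp: strings_def supp_def)
  show "(\<lambda>P. (P q, P(q := PI))) ` strings (insert q S) \<subseteq> UNIV \<times> strings S"
    by (auto simp: strings_def supp_def split: if_splits)
qed simp

text \<open>A string on \<open>S\<close> is a free choice of one letter per qubit, so this is
  distributivity again; it reduces sums over strings to single-qubit sums.\<close>

lemma sum_strings_prod:
  fixes g :: "nat \<Rightarrow> pauli \<Rightarrow> 'a::comm_semiring_1"
  assumes "finite S"
  shows "(\<Sum>A\<in>strings S. \<Prod>q\<in>S. g q (A q)) = (\<Prod>q\<in>S. \<Sum>a\<in>UNIV. g q a)"
  using assms
proof induction
  case (insert q S)
  have "(\<Sum>A\<in>strings (insert q S). \<Prod>q\<in>insert q S. g q (A q)) =
    (\<Sum>(a, P)\<in>UNIV \<times> strings S. \<Prod>r\<in>insert q S. g r ((P(q := a)) r))"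
    using sum.reindex_bij_betw[OF strings_insert[OF insert(2)],
        of "\<lambda>A. \<Prod>q\<in>insert q S. g q (A q)"] by (simp add: case_prod_beta)
  also have "\<dots> = (\<Sum>a\<in>UNIV. \<Sum>P\<in>strings S. g q a * (\<Prod>r\<in>S. g r (P r)))"
    unfolding sum.cartesian_product[symmetric]
  proof (intro sum.cong refl)
    fix a P
    have "(\<Prod>r\<in>S. g r ((P(q := a)) r)) = (\<Prod>r\<in>S. g r (P r))"
      by (rule prod.cong) (use insert(2) in auto)
    then show "(\<Prod>r\<in>insert q S. g r ((P(q := a)) r)) = g q a * (\<Prod>r\<in>S. g r (P r))"
      using insert(1,2) by simp
  qed
  also have "\<dots> = (\<Sum>a\<in>UNIV. g q a) * (\<Prod>q\<in>S. \<Sum>a\<in>UNIV. g q a)"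
    by (simp only: sum_distrib_left[symmetric] insert.IH sum_distrib_right[symmetric])
  finally show ?case
    using insert(1,2) by simp
qed (simp add: strings_empty)

lemma sum_strings_prod2:
  fixes g :: "nat \<Rightarrow> pauli \<Rightarrow> pauli \<Rightarrow> 'a::comm_semiring_1"
  assumes "finite S"
  shows "(\<Sum>A\<in>strings S. \<Sum>B\<in>strings S. \<Prod>q\<in>S. g q (A q) (B q)) =
    (\<Prod>q\<in>S. \<Sum>a\<in>UNIV. \<Sum>b\<in>UNIV. g q a b)"
proof -
  have "(\<Sum>A\<in>strings S. \<Sum>B\<in>strings S. \<Prod>q\<in>S. g q (A q) (B q)) =
    (\<Sum>A\<in>strings S. \<Prod>q\<in>S. \<Sum>b\<in>UNIV. g q (A q) b)"
    by (intro sum.cong refl sum_strings_prod assms)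
  then show ?thesis
    using sum_strings_prod[OF assms, of "\<lambda>q a. \<Sum>b\<in>UNIV. g q a b"] by simp
qed

section \<open>Local estimates\<close>

lemma mtrace_mult_msum:
  assumes "M \<in> ops n" and "\<And>x. x \<in> X \<Longrightarrow> f x \<in> ops n"
  shows "mtrace (M * msum n X f) = (\<Sum>x\<in>X. mtrace (M * f x))"
proof -
  have "mtrace (M * msum n X f) =
      (\<Sum>i<2 ^ n. \<Sum>j<2 ^ n. \<Sum>x\<in>X. M $$ (i, j) * f x $$ (j, i))"
    using assms(1) by (simp add: mtrace_def msum_def scalar_prod_def sum_distrib_left atLeast0LessThan)
  also have "\<dots> = (\<Sum>x\<in>X. \<Sum>i<2 ^ n. \<Sum>j<2 ^ n. M $$ (i, j) * f x $$ (j, i))"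
    by (simp only: sum.swap[where A = X])
  also have "\<dots> = (\<Sum>x\<in>X. mtrace (M * f x))"
  proof (rule sum.cong)
    fix x assume "x \<in> X"
    then have "f x \<in> ops n" by (rule assms(2))
    then show "(\<Sum>i<2 ^ n. \<Sum>j<2 ^ n. M $$ (i, j) * f x $$ (j, i)) = mtrace (M * f x)"
      using assms(1) by (simp add: mtrace_def scalar_prod_def atLeast0LessThan)
  qed simp
  finally show ?thesis .
qed

lemma mtrace_mult_smult:
  assumes "M \<in> ops n" "N \<in> ops n"
  shows "mtrace (M * (c \<cdot>\<^sub>m N)) = c * mtrace (M * N)"
  using assms by (simp add: mtrace_def scalar_prod_def sum_distrib_left ac_simps)

text \<open>Inserting the \<chi>-expansion of \<open>L\<close> makes a PTM entry a linear form in
  the coefficients whose weights tr(A P B Q) factorize over the qubits.\<close>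

lemma ptm_chi:
  assumes "chi_coeffs n L chi"
  shows "ptm n L A B =
    (\<Sum>(P, Q)\<in>strings {..<n} \<times> strings {..<n}.
       chi P Q * (\<Prod>q<n. pauli_tr (A q) (P q) (B q) (Q q))) / 2 ^ n"
proof -
  have tr: "mtrace (pmat n A * (c \<cdot>\<^sub>m (pmat n P * pmat n B * pmat n Q))) =
      c * (\<Prod>q<n. pauli_tr (A q) (P q) (B q) (Q q))" for c P Q
  proof -
    have "pmat n A * (pmat n P * pmat n B * pmat n Q) = pmat n A * pmat n P * pmat n B * pmat n Q"
      using assoc_mult_mat[OF pmat_carrier mult_carrier_mat[OF pmat_carrier pmat_carrier] pmat_carrier]
        assoc_mult_mat[OF pmat_carrier pmat_carrier pmat_carrier] by metis
    then show ?thesis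
      using mtrace_mult_smult[OF pmat_carrier mult_carrier_mat[OF
          mult_carrier_mat[OF pmat_carrier pmat_carrier] pmat_carrier]]
      by (simp add: mtrace_pauli4 atLeast0LessThan)
  qed
  have "mtrace (pmat n A * L (pmat n B)) =
      (\<Sum>x\<in>strings {..<n} \<times> strings {..<n}.
         mtrace (pmat n A * (\<lambda>(P, Q). chi P Q \<cdot>\<^sub>m (pmat n P * pmat n B * pmat n Q)) x))"
    using assms unfolding chi_coeffs_def
    by (simp add: mtrace_mult_msum case_prod_beta mult_carrier_mat[of _ _ "2 ^ n"])
  then show ?thesis
    by (simp add: ptm_def tr case_prod_beta)
qed

lemma prod_if_zero:
  "finite F \<Longrightarrow> (\<Prod>q\<in>F. if c q then r else 0) = (if \<forall>q\<in>F. c q then r ^ card F else 0)"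
  for r :: "'a::comm_semiring_1"
  by (induction F rule: finite_induct) auto

text \<open>Off \<open>S\<close> both \<open>A\<close> and \<open>B\<close> are the identity, so
  each such qubit contributes tr(P' Q'), which is 2 or 0. On \<open>S\<close> single-qubit
  completeness gives 16 or 0.\<close>

lemma pauli_tr_local_sum:
  assumes S: "S \<subseteq> {..<n}"
  shows "(\<Sum>A\<in>strings S. \<Sum>B\<in>strings S. (\<Prod>q<n. pauli_tr (A q) (P' q) (B q) (Q' q)) *
      (\<Prod>q\<in>S. pauli_tr (A q) (Q q) (B q) (P q))) =
    (if (\<forall>q\<in>S. P' q = P q \<and> Q' q = Q q) \<and> (\<forall>q\<in>{..<n} - S. P' q = Q' q)
     then 16 ^ card S * 2 ^ (n - card S) else 0)"
proof -
  have fin: "finite S" using S finite_subset by blast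
  define g where "g q a b = pauli_tr a (P' q) b (Q' q) * pauli_tr a (Q q) b (P q)" for q a b
  define r :: complex where "r = (\<Prod>q\<in>{..<n} - S. if P' q = Q' q then 2 else 0)"
  have "(\<Prod>q<n. pauli_tr (A q) (P' q) (B q) (Q' q)) * (\<Prod>q\<in>S. pauli_tr (A q) (Q q) (B q) (P q)) =
      r * (\<Prod>q\<in>S. g q (A q) (B q))" if "A \<in> strings S" "B \<in> strings S" for A B
  proof -
    have "(\<Prod>q\<in>{..<n} - S. pauli_tr (A q) (P' q) (B q) (Q' q)) = r"
      unfolding r_def
    proof (rule prod.cong)
      fix q assume "q \<in> {..<n} - S"
      then have "A q = PI" "B q = PI" using that by (auto simp: strings_def supp_def)
      then show "pauli_tr (A q) (P' q) (B q) (Q' q) = (if P' q = Q' q then 2 else 0)"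
        by (simp add: pauli_tr_PI)
    qed simp
    then show ?thesis
      by (simp add: prod.subset_diff[OF S] g_def prod.distrib)
  qed
  then have "(\<Sum>A\<in>strings S. \<Sum>B\<in>strings S. (\<Prod>q<n. pauli_tr (A q) (P' q) (B q) (Q' q)) *
      (\<Prod>q\<in>S. pauli_tr (A q) (Q q) (B q) (P q))) =
      r * (\<Sum>A\<in>strings S. \<Sum>B\<in>strings S. \<Prod>q\<in>S. g q (A q) (B q))"
    by (simp add: sum_distrib_left)
  also have "\<dots> = r * (\<Prod>q\<in>S. if P' q = P q \<and> Q' q = Q q then 16 else 0)"
    unfolding sum_strings_prod2[OF fin] by (simp add: g_def pauli_tr_completeness)
  also have "\<dots> = (if (\<forall>q\<in>S. P' q = P q \<and> Q' q = Q q) \<and> (\<forall>q\<in>{..<n} - S. P' q = Q' q)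
     then 16 ^ card S * 2 ^ (n - card S) else 0)"
    unfolding r_def using S fin by (simp add: prod_if_zero card_Diff_subset)
  finally show ?thesis .
qed

lemma chi_hat_ptm:
  assumes chi: "chi_coeffs n L chi" and S: "S \<subseteq> {..<n}" and PQ: "P \<in> strings S" "Q \<in> strings S"
  shows "chi_hat (ptm n L) S P Q = (\<Sum>A\<in>strings ({..<n} - S). chi (tensor S P A) (tensor S Q A))"
proof -
  have fin: "finite S" using S finite_subset by blast
  let ?X = "strings {..<n} \<times> strings {..<n}"
  let ?c = "\<lambda>P' Q'. (\<forall>q\<in>S. P' q = P q \<and> Q' q = Q q) \<and> (\<forall>q\<in>{..<n} - S. P' q = Q' q)"
  obtain d where n: "n = card S + d"
    using card_mono[OF _ S] le_Suc_ex by auto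
  \<comment> \<open>The weight of a surviving pair equals the product of the normalizations of
    \<open>ptm\<close> and \<open>chi_hat\<close>.\<close>
  have pow: "16 ^ card S * 2 ^ (n - card S) = (2 ^ n * 2 ^ (3 * card S) :: complex)"
    by (simp add: n power_mult power_add power_mult_distrib[symmetric])
  have "chi_hat (ptm n L) S P Q =
      (\<Sum>A\<in>strings S. \<Sum>B\<in>strings S. \<Sum>x\<in>?X. chi (fst x) (snd x) *
        ((\<Prod>q<n. pauli_tr (A q) (fst x q) (B q) (snd x q)) *
         (\<Prod>q\<in>S. pauli_tr (A q) (Q q) (B q) (P q)))) / (2 ^ n * 2 ^ (3 * card S))"
    using fin by (simp add: chi_hat_def ptm_chi[OF chi] mtrace_pauli4 case_prod_beta
        sum_distrib_right sum_divide_distrib mult.assoc)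
  also have "\<dots> = (\<Sum>x\<in>?X. chi (fst x) (snd x) *
        (\<Sum>A\<in>strings S. \<Sum>B\<in>strings S. (\<Prod>q<n. pauli_tr (A q) (fst x q) (B q) (snd x q)) *
         (\<Prod>q\<in>S. pauli_tr (A q) (Q q) (B q) (P q)))) / (2 ^ n * 2 ^ (3 * card S))"
    by (simp only: sum_distrib_left sum.swap[where A = ?X])
  also have "\<dots> = (\<Sum>x\<in>?X. if ?c (fst x) (snd x) then chi (fst x) (snd x) else 0)"
    unfolding pauli_tr_local_sum[OF S] sum_divide_distrib
    by (rule sum.cong) (auto simp: pow)
  also have "\<dots> = (\<Sum>x\<in>{x \<in> ?X. ?c (fst x) (snd x)}. chi (fst x) (snd x))"
    by (rule sum.inter_filter[symmetric]) (simp add: finite_strings)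
  \<comment> \<open>The two strings of a surviving pair agree off \<open>S\<close>, so their common
    part \<open>A\<close> can be read off from the first one.\<close>
  also have "\<dots> = (\<Sum>A\<in>strings ({..<n} - S). chi (tensor S P A) (tensor S Q A))"
  proof (rule sum.reindex_bij_witness[where i = "\<lambda>A. (tensor S P A, tensor S Q A)"
        and j = "\<lambda>x. restr ({..<n} - S) (fst x)"])
    fix x assume x: "x \<in> {x \<in> ?X. ?c (fst x) (snd x)}"
    have out: "fst x q = PI" "snd x q = PI" if "\<not> q < n" for q
      using x that by (auto simp: strings_def supp_def)
    have P: "tensor S P (restr ({..<n} - S) (fst x)) = fst x"
      using x out by (auto simp: tensor_def restr_def fun_eq_iff)
    have Q: "tensor S Q (restr ({..<n} - S) (fst x)) = snd x"
      using x out by (auto simp: tensor_def restr_def fun_eq_iff)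
    show "(tensor S P (restr ({..<n} - S) (fst x)), tensor S Q (restr ({..<n} - S) (fst x))) = x"
      by (simp add: P Q)
    show "chi (tensor S P (restr ({..<n} - S) (fst x))) (tensor S Q (restr ({..<n} - S) (fst x))) =
        chi (fst x) (snd x)"
      by (simp add: P Q)
    show "restr ({..<n} - S) (fst x) \<in> strings ({..<n} - S)"
      by (auto simp: strings_def supp_def restr_def)
  next
    fix A assume A: "A \<in> strings ({..<n} - S)"
    then have "A q = PI" if "q \<notin> {..<n} - S" for q
      using that by (auto simp: strings_def supp_def)
    then show "restr ({..<n} - S) (fst (tensor S P A, tensor S Q A)) = A"
      by (auto simp: restr_def tensor_def fun_eq_iff)
    have "tensor S R A \<in> strings {..<n}" if "R \<in> strings S" for R
      using A S that by (auto simp: strings_def supp_def tensor_def split: if_splits)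
    then show "(tensor S P A, tensor S Q A) \<in> {x \<in> ?X. ?c (fst x) (snd x)}"
      using PQ by (auto simp: tensor_def)
  qed
  finally show ?thesis .
qed

text \<open>The moduli of the traces sum to \<open>8 ^ card S\<close>, exactly the normalization, so
  errors of the PTM entries are averaged and not amplified.\<close>

lemma chi_hat_perturbation:
  assumes fin: "finite S"
    and close: "\<And>A B. A \<in> strings S \<Longrightarrow> B \<in> strings S \<Longrightarrow> cmod (M A B - N A B) \<le> \<epsilon>"
  shows "cmod (chi_hat M S P Q - chi_hat N S P Q) \<le> \<epsilon>"
proof -
  let ?t = "\<lambda>A B. \<Prod>q\<in>S. pauli_tr (A q) (Q q) (B q) (P q)"
  have "chi_hat M S P Q - chi_hat N S P Q =
      (\<Sum>A\<in>strings S. \<Sum>B\<in>strings S. (M A B - N A B) * ?t A B) / 2 ^ (3 * card S)"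
    using fin by (simp add: chi_hat_def mtrace_pauli4 left_diff_distrib sum_subtractf diff_divide_distrib)
  then have "cmod (chi_hat M S P Q - chi_hat N S P Q) =
      cmod (\<Sum>A\<in>strings S. \<Sum>B\<in>strings S. (M A B - N A B) * ?t A B) / 2 ^ (3 * card S)"
    by (simp add: norm_divide norm_power)
  also have "\<dots> \<le> (\<Sum>A\<in>strings S. \<Sum>B\<in>strings S. \<epsilon> * cmod (?t A B)) / 2 ^ (3 * card S)"
    using close
    by (intro divide_right_mono order_trans[OF norm_sum] sum_mono)
      (auto simp: norm_mult intro!: mult_right_mono)
  also have "\<dots> = \<epsilon> * (\<Sum>A\<in>strings S. \<Sum>B\<in>strings S. \<Prod>q\<in>S. cmod (pauli_tr (A q) (Q q) (B q) (P q))) / 2 ^ (3 * card S)"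
    by (simp add: sum_distrib_left prod_norm)
  also have "\<dots> = \<epsilon>"
    unfolding sum_strings_prod2[OF fin, where g = "\<lambda>q a b. cmod (pauli_tr a (Q q) b (P q))"]
    by (simp add: sum_norm_pauli_tr power_mult)
  finally show ?thesis .
qed

section \<open>Error propagation in the sweep\<close>

lemma result_simps [simp]:
  "result (return x) = x"
  "result (bind_timed c f) = result (f (result c))"
  "result (tick t) = ()"
  by (simp_all add: return_def bind_timed_def tick_def)

lemma result_for_each [simp]: "result (for_each xs f s) = fold (\<lambda>x s. result (f x s)) xs s"
  by (induction xs arbitrary: s) simp_all

lemma set_all_subsets [simp]: "set (result (all_subsets qs)) = Pow (set qs)"
  by (induction qs) (auto simp: Pow_insert)

lemma distinct_all_subsets: "distinct qs \<Longrightarrow> distinct (result (all_subsets qs))"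
proof (induction qs)
  case (Cons q qs)
  then have "inj_on (insert q) (Pow (set qs))"
    by (auto simp: inj_on_def)
  with Cons show ?case
    by (auto simp: distinct_map)
qed simp

lemma restr_supp:
  assumes "supp P \<subseteq> S"
  shows "restr S P = P"
proof -
  have "P q = PI" if "q \<notin> S" for q using assms that by (auto simp: supp_def)
  then show ?thesis by (auto simp: restr_def fun_eq_iff)
qed

text \<open>\<open>extends r pq\<close> means that the register \<open>r\<close> is increased when the pair \<open>pq\<close> is accepted.\<close>

definition extends :: "key \<Rightarrow> pstring \<times> pstring \<Rightarrow> bool" where
  "extends = (\<lambda>(T, U, V) (P, Q). T \<noteq> {} \<and> T \<subset> supp P \<union> supp Q \<and>
     restr (supp P \<union> supp Q - T) P = restr (supp P \<union> supp Q - T) Q \<and>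
     restr T P = U \<and> restr T Q = V)"

text \<open>The iteration for \<open>T\<close> touches only a cell with first component
  \<open>T\<close>; for distinct subsets every matching cell is therefore increased exactly
  once.\<close>

lemma fold_register_update:
  assumes "distinct Ts"
  shows "fold (\<lambda>T st. if c T
        then st\<lparr>register := (register st)((T, f T, g T) := register st (T, f T, g T) + v)\<rparr> else st) Ts st =
      st\<lparr>register := (\<lambda>r. register st r +
        (if fst r \<in> set Ts \<and> c (fst r) \<and> snd r = (f (fst r), g (fst r)) then v else 0))\<rparr>"
  using assms
proof (induction Ts arbitrary: st)
  case (Cons T Ts)
  then show ?case
    by (cases "c T") (auto intro!: rec_state.equality ext)
qed simp

text \<open>The loop over subsets becomes one pointwise update, since the cells it touches are
  exactly those related to the pair by \<open>extends\<close>. \<open>P\<close> and \<open>Q\<close>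
  equal their restrictions to the support union.\<close>

lemma result_visit:
  fixes tab :: "key \<Rightarrow> complex"
  assumes "finite (supp P \<union> supp Q)"
  defines "v \<equiv> \<lambda>st. tab (supp P \<union> supp Q, P, Q) - register st (supp P \<union> supp Q, P, Q)"
  shows "result (visit lam tab (P, Q) st) =
    (if cmod (v st) > lam
     then \<lparr>accepted = insert (P, Q) (accepted st), estimate = (estimate st)((P, Q) := v st),
           register = (\<lambda>r. register st r + (if extends r (P, Q) then v st else 0))\<rparr>
     else st)"
proof -
  let ?S = "supp P \<union> supp Q"
  let ?c = "\<lambda>T. T \<noteq> {} \<and> T \<subset> ?S \<and> restr (?S - T) P = restr (?S - T) Q"
  have ext: "(fst r \<in> set (result (all_subsets (sorted_list_of_set ?S))) \<and> ?c (fst r) \<and>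
      snd r = (restr (fst r) P, restr (fst r) Q)) = extends r (P, Q)" for r
    using assms(1) by (cases r) (auto simp: extends_def)
  have "result (visit lam tab (P, Q) st) = (if cmod (v st) > lam then
     fold (\<lambda>T st'. if ?c T
        then st'\<lparr>register := (register st')((T, restr T P, restr T Q) :=
          register st' (T, restr T P, restr T Q) + v st)\<rparr> else st')
       (result (all_subsets (sorted_list_of_set ?S)))
       (st\<lparr>accepted := insert (P, Q) (accepted st), estimate := (estimate st)((P, Q) := v st)\<rparr>)
     else st)"
    by (simp add: visit_def Let_def restr_supp v_def if_distrib[where f = result] cong: if_cong)
  also have "\<dots> = (if cmod (v st) > lam
     then \<lparr>accepted = insert (P, Q) (accepted st), estimate = (estimate st)((P, Q) := v st),
           register = (\<lambda>r. register st r + (if extends r (P, Q) then v st else 0))\<rparr>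
     else st)"
    unfolding fold_register_update[OF distinct_all_subsets[OF distinct_sorted_list_of_set]] ext
    by simp
  finally show ?thesis .
qed

section \<open>Degree, residual mass and extensions of a pair\<close>

lemma supp_empty_iff: "supp P = {} \<longleftrightarrow> P = id_str"
  by (auto simp: supp_def id_str_def)

lemma finite_supp: "P \<in> strings {..<n} \<Longrightarrow> finite (supp P)"
  by (auto simp: strings_def intro: finite_subset)

text \<open>\<open>Max\<close> in \<open>ddeg\<close> and \<open>rho\<close> is known to be an upper
  bound only over a finite set.\<close>

lemma finite_parameter_set:
  "finite {f S P Q | S P Q. S \<subseteq> {..<n::nat} \<and> P \<in> strings S \<and> Q \<in> strings S}"
proof (rule finite_subset)
  let ?X = "Pow {..<n} \<times> strings {..<n} \<times> strings {..<n}"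
  show "{f S P Q | S P Q. S \<subseteq> {..<n} \<and> P \<in> strings S \<and> Q \<in> strings S} \<subseteq> (\<lambda>(S, P, Q). f S P Q) ` ?X"
    by (force simp: strings_def image_iff)
  show "finite ((\<lambda>(S, P, Q). f S P Q) ` ?X)"
    by (intro finite_imageI finite_cartesian_product) (simp_all add: finite_strings)
qed

lemma card_le_ddeg:
  assumes "S \<subseteq> {..<n}" "P \<in> strings S" "Q \<in> strings S"
  shows "card {A \<in> strings ({..<n} - S) - {id_str}. (tensor S P A, tensor S Q A) \<in> \<Omega>} \<le> ddeg n \<Omega>"
  unfolding ddeg_def by (rule Max_ge[OF finite_parameter_set]) (use assms in blast)

lemma sum_le_rho:
  assumes "S \<subseteq> {..<n}" "P \<in> strings S" "Q \<in> strings S"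
  shows "(\<Sum>A\<in>{A \<in> strings ({..<n} - S) - {id_str}. (tensor S P A, tensor S Q A) \<notin> \<Omega>}.
      cmod (chi (tensor S P A) (tensor S Q A))) \<le> rho n chi \<Omega>"
  unfolding rho_def by (rule Max_ge[OF finite_parameter_set]) (use assms in blast)

lemma rho_nonneg: "rho n chi \<Omega> \<ge> 0"
  by (rule order_trans[OF sum_nonneg sum_le_rho[of "{}" n id_str id_str]]) (auto simp: strings_empty)

lemma supp_tensor:
  assumes "supp P \<union> supp Q = S" "A \<in> strings ({..<n} - S)"
  shows "supp (tensor S P A) \<union> supp (tensor S Q A) = S \<union> supp A"
  using assms by (auto simp: supp_def tensor_def strings_def split: if_splits)

text \<open>A non-identity string off \<open>S\<close> adds qubits to the support union. Hence
  extensions of a pair come before it in the sweep.\<close>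

lemma card_supp_tensor:
  assumes "supp P \<union> supp Q = S" "finite S" "A \<in> strings ({..<n} - S) - {id_str}"
  shows "card S < card (supp2 (tensor S P A, tensor S Q A))"
proof -
  have "supp A \<noteq> {}" "supp A \<inter> S = {}" "finite (supp A)"
    using assms(3) by (auto simp: strings_def supp_def id_str_def intro: finite_subset[of _ "{..<n}"])
  then show ?thesis
    using assms supp_tensor[of P Q S A n]
    by (simp add: supp2_def card_Un_disjoint Int_commute card_gt_0_iff)
qed

text \<open>Matches the combinatorics of \<open>ddeg\<close> and \<open>rho\<close>, which count
  strings \<open>A\<close>, with the register updates, which are triggered by pairs. The inverse
  reads off the common part off \<open>S\<close>; \<open>S\<close> is nonempty because
  \<open>extends\<close> admits only nonempty keys.\<close>

lemma extensions_bij: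
  assumes S: "supp P \<union> supp Q = S" "S \<noteq> {}" "S \<subseteq> {..<n}"
    and X: "X \<subseteq> strings {..<n} \<times> strings {..<n}"
  shows "bij_betw (\<lambda>A. (tensor S P A, tensor S Q A))
    {A \<in> strings ({..<n} - S) - {id_str}. (tensor S P A, tensor S Q A) \<in> X} {pq \<in> X. extends (S, P, Q) pq}"
proof (rule bij_betw_byWitness[where f' = "\<lambda>pq. restr ({..<n} - S) (fst pq)"])
  let ?E = "{A \<in> strings ({..<n} - S) - {id_str}. (tensor S P A, tensor S Q A) \<in> X}"
  have restr_tensor: "restr ({..<n} - S) (tensor S P A) = A" if "A \<in> strings ({..<n} - S)" for A
  proof -
    have "A q = PI" if "q \<notin> {..<n} - S" for q
      using \<open>A \<in> _\<close> that by (auto simp: strings_def supp_def)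
    then show ?thesis by (auto simp: restr_def tensor_def fun_eq_iff)
  qed
  then show "\<forall>A\<in>?E. restr ({..<n} - S) (fst (tensor S P A, tensor S Q A)) = A"
    by simp
  have tensor_restr: "tensor S P (restr ({..<n} - S) P') = P' \<and> tensor S Q (restr ({..<n} - S) P') = Q'"
    and not_id: "restr ({..<n} - S) P' \<noteq> id_str"
    if "(P', Q') \<in> X" "extends (S, P, Q) (P', Q')" for P' Q'
  proof -
    have ext: "S \<subset> supp P' \<union> supp Q'" "restr (supp P' \<union> supp Q' - S) P' = restr (supp P' \<union> supp Q' - S) Q'"
      "restr S P' = P" "restr S Q' = Q"
      using that(2) by (auto simp: extends_def)
    \<comment> \<open>Outside the support union both letters are \<open>PI\<close>, so agreement on
      the union minus \<open>S\<close> is agreement off \<open>S\<close>.\<close>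
    have eq: "P' q = Q' q" if "q \<notin> S" for q
      using fun_cong[OF ext(2), of q] that by (auto simp: restr_def supp_def split: if_splits)
    have out: "P' q = PI" "Q' q = PI" if "\<not> q < n" for q
      using \<open>(P', Q') \<in> X\<close> that X by (auto simp: strings_def supp_def)
    have "P q = P' q" "Q q = Q' q" if "q \<in> S" for q
      using fun_cong[OF ext(3), of q] fun_cong[OF ext(4), of q] that by (auto simp: restr_def)
    then show "tensor S P (restr ({..<n} - S) P') = P' \<and> tensor S Q (restr ({..<n} - S) P') = Q'"
      using eq out by (auto simp: tensor_def restr_def fun_eq_iff)
    obtain q where q: "q \<notin> S" "q \<in> supp P' \<union> supp Q'" using ext(1) by blast
    then have "P' q \<noteq> PI" using eq[of q] by (auto simp: supp_def)
    then have "restr ({..<n} - S) P' q \<noteq> PI" using out(1)[of q] q by (auto simp: restr_def)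
    then show "restr ({..<n} - S) P' \<noteq> id_str" by (auto simp: id_str_def)
  qed
  show "\<forall>pq\<in>{pq \<in> X. extends (S, P, Q) pq}.
      (tensor S P (restr ({..<n} - S) (fst pq)), tensor S Q (restr ({..<n} - S) (fst pq))) = pq"
    using tensor_restr by auto
  show "(\<lambda>pq. restr ({..<n} - S) (fst pq)) ` {pq \<in> X. extends (S, P, Q) pq} \<subseteq> ?E"
    using tensor_restr not_id by (auto simp: strings_def supp_def restr_def split: if_splits)
  show "(\<lambda>A. (tensor S P A, tensor S Q A)) ` ?E \<subseteq> {pq \<in> X. extends (S, P, Q) pq}"
  proof (clarsimp simp: extends_def S(2), intro conjI)
    fix A assume A: "A \<in> strings ({..<n} - S)" "A \<noteq> id_str"
    have "finite S" using S(3) finite_subset by blast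
    then show "S \<subset> supp (tensor S P A) \<union> supp (tensor S Q A)"
      using card_supp_tensor[OF S(1), of A n] supp_tensor[OF S(1) A(1)] A by (auto simp: supp2_def)
    have "P q = PI" "Q q = PI" if "q \<notin> S" for q using S(1) that by (auto simp: supp_def)
    then show "restr S (tensor S P A) = P" "restr S (tensor S Q A) = Q"
      by (auto simp: restr_def tensor_def fun_eq_iff)
    show "restr (supp (tensor S P A) \<union> supp (tensor S Q A) - S) (tensor S P A) =
        restr (supp (tensor S P A) \<union> supp (tensor S Q A) - S) (tensor S Q A)"
      by (auto simp: restr_def tensor_def)
  qed
qed

section \<open>Valid keys and the invariant of the sweep\<close>

definition valid_key :: "nat \<Rightarrow> nat \<Rightarrow> key \<Rightarrow> bool" where
  "valid_key n k = (\<lambda>(S, P, Q). S \<subseteq> {..<n} \<and> S \<noteq> {} \<and> card S \<le> k \<and> P \<in> strings S \<and> Q \<in> strings S)"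

text \<open>Abstracts from the origin of the table, so that one analysis covers both programs.
  Closeness is assumed at valid keys only, the cells that \<open>prepare\<close> fills.\<close>

locale guarded_sweep =
  fixes n k :: nat and chi :: "pstring \<Rightarrow> pstring \<Rightarrow> complex" and lam \<gamma> \<epsilon> :: real
    and tab :: "key \<Rightarrow> complex" and \<Omega>m \<Omega>p :: "(pstring \<times> pstring) set" and d \<rho> :: real
  assumes tab: "valid_key n k (S, P, Q) \<Longrightarrow>
      cmod (tab (S, P, Q) - (\<Sum>A\<in>strings ({..<n} - S). chi (tensor S P A) (tensor S Q A))) \<le> \<epsilon>"
    and margin: "(\<Sum>l=0..k. d ^ l) * (\<epsilon> + \<rho>) \<le> \<gamma>"
    and \<Omega>m_def: "\<Omega>m = Omega n k chi (lam - \<gamma>)" and \<Omega>p_def: "\<Omega>p = Omega n k chi (lam + \<gamma>)"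
    and d_def: "d = real (ddeg n \<Omega>m)" and \<rho>_def: "\<rho> = rho n chi \<Omega>p"
begin

text \<open>The solution of the error recursion, where \<open>j\<close> is the distance of the
  support size from \<open>k\<close>.\<close>

definition bound :: "nat \<Rightarrow> real" where
  "bound j = (\<Sum>l\<le>j. d ^ l) * (\<epsilon> + \<rho>)"

text \<open>\<open>ys\<close> lists the pairs visited so far. The register clause is restricted to
  valid keys because \<open>prepare\<close> clears no other registers.\<close>

definition invariant :: "(pstring \<times> pstring) list \<Rightarrow> rec_state \<Rightarrow> bool" where
  "invariant ys st \<longleftrightarrow> accepted st \<subseteq> set ys \<inter> \<Omega>m \<and> set ys \<inter> \<Omega>p \<subseteq> accepted st \<and>
     (\<forall>(P, Q)\<in>accepted st. cmod (estimate st (P, Q) - chi P Q) \<le> bound (k - card (supp2 (P, Q)))) \<and>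
     (\<forall>r. valid_key n k r \<longrightarrow> register st r = (\<Sum>pq\<in>{pq \<in> accepted st. extends r pq}. estimate st pq))"

lemma d_nonneg: "d \<ge> 0"
  by (simp add: d_def)

lemma Omega_strings: "\<Omega>m \<subseteq> strings {..<n} \<times> strings {..<n}"
  by (auto simp: \<Omega>m_def Omega_def local_pairs0_def local_pairs_def)

lemma bound_Suc: "bound (Suc j) = \<epsilon> + \<rho> + d * bound j"
  by (simp add: bound_def sum.atMost_Suc_shift sum_distrib_left[symmetric] algebra_simps
      del: sum.atMost_Suc)

lemma bound_mono: "\<epsilon> + \<rho> \<ge> 0 \<Longrightarrow> i \<le> j \<Longrightarrow> bound i \<le> bound j"
  unfolding bound_def by (intro mult_right_mono sum_mono2) (auto simp: d_nonneg)

lemma bound_le_margin: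
  assumes "\<epsilon> + \<rho> \<ge> 0" "j \<le> k"
  shows "bound j \<le> \<gamma>"
  using bound_mono[OF assms] margin by (simp add: bound_def atMost_atLeast0)

text \<open>The error has three parts: the table error (at most \<epsilon>), the estimation errors
  of the accepted extensions (at most \<open>d\<close> of them, each bounded one level up), and the
  coefficients of the other extensions (together at most \<rho>).\<close>

lemma
  assumes inv: "invariant ys st" and x: "(P, Q) \<in> local_pairs n k" and S: "supp P \<union> supp Q = S" "S \<noteq> {}"
    and larger: "\<And>y. y \<in> local_pairs n k \<Longrightarrow> card S < card (supp2 y) \<Longrightarrow> y \<in> set ys"
  shows visit_error: "cmod (tab (S, P, Q) - register st (S, P, Q) - chi P Q) \<le> bound (k - card S)"
    and visit_eps: "\<epsilon> + \<rho> \<ge> 0"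
proof -
  let ?acc = "accepted st" and ?F = "strings ({..<n} - S) - {id_str}"
  let ?t = "\<lambda>A. (tensor S P A, tensor S Q A)"
  let ?chi = "\<lambda>A. chi (tensor S P A) (tensor S Q A)"
  have strs: "P \<in> strings {..<n}" "Q \<in> strings {..<n}" and cardS: "card S \<le> k"
    using x S by (auto simp: local_pairs_def supp2_def)
  then have Sn: "S \<subseteq> {..<n}" using S by (auto simp: strings_def)
  then have finS: "finite S" by (rule finite_subset) simp
  have PS: "P \<in> strings S" "Q \<in> strings S" using S by (auto simp: strings_def)
  have valid: "valid_key n k (S, P, Q)"
    using Sn S(2) cardS PS by (simp add: valid_key_def)
  have finF: "finite ?F" by (simp add: finite_strings)
  define E where "E = {A \<in> ?F. ?t A \<in> ?acc}"
  have acc: "?acc \<subseteq> \<Omega>m" "set ys \<inter> \<Omega>p \<subseteq> ?acc" using inv by (auto simp: invariant_def)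
  have reg: "register st (S, P, Q) = (\<Sum>A\<in>E. estimate st (?t A))"
  proof -
    have "register st (S, P, Q) = (\<Sum>pq\<in>{pq \<in> ?acc. extends (S, P, Q) pq}. estimate st pq)"
      using inv valid by (simp add: invariant_def)
    also have "\<dots> = (\<Sum>A\<in>E. estimate st (?t A))"
      unfolding E_def using acc(1) Omega_strings
      by (intro sum.reindex_bij_betw[symmetric] extensions_bij S Sn) blast
    finally show ?thesis .
  qed
  \<comment> \<open>No sign of \<epsilon> is assumed; it follows because \<epsilon> bounds a norm at
    a valid key.\<close>
  have eps0: "\<epsilon> \<ge> 0"
    using order_trans[OF norm_ge_zero tab[OF valid]] .
  have rho0: "\<rho> \<ge> 0" by (simp add: \<rho>_def rho_nonneg)
  show er0: "\<epsilon> + \<rho> \<ge> 0" using eps0 rho0 by simp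
  have t_id: "?t id_str = (P, Q)"
  proof -
    have "P q = PI" "Q q = PI" if "q \<notin> S" for q using S(1) that by (auto simp: supp_def)
    then show ?thesis by (auto simp: tensor_def id_str_def fun_eq_iff)
  qed
  have "id_str \<in> strings ({..<n} - S)" by (auto simp: strings_def supp_def id_str_def)
  then have loc: "(\<Sum>A\<in>strings ({..<n} - S). ?chi A) = chi P Q + (\<Sum>A\<in>?F. ?chi A)"
    using t_id by (subst sum.remove) (auto simp: finite_strings)
  also have "(\<Sum>A\<in>?F. ?chi A) = (\<Sum>A\<in>E. ?chi A) + (\<Sum>A\<in>?F - E. ?chi A)"
    using finF by (subst sum.subset_diff[of E]) (auto simp: E_def add.commute)
  \<comment> \<open>The summand of the identity string is \<open>chi P Q\<close>; the remaining
    strings are split into accepted ones (\<open>E\<close>) and the others.\<close>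
  finally have split: "tab (S, P, Q) - register st (S, P, Q) - chi P Q =
      (tab (S, P, Q) - (\<Sum>A\<in>strings ({..<n} - S). ?chi A)) +
      (\<Sum>A\<in>E. ?chi A - estimate st (?t A)) + (\<Sum>A\<in>?F - E. ?chi A)"
    by (simp add: reg sum_subtractf)
  have card_gt: "card S < card (supp2 (?t A))" if "A \<in> ?F" for A
    using card_supp_tensor[OF S(1) finS that] .
  have "cmod (\<Sum>A\<in>?F - E. ?chi A) \<le> (\<Sum>A\<in>?F - E. cmod (?chi A))"
    by (rule norm_sum)
  also have "\<dots> \<le> (\<Sum>A\<in>{A \<in> ?F. ?t A \<notin> \<Omega>p}. cmod (?chi A))"
  proof (rule sum_mono2)
    show "?F - E \<subseteq> {A \<in> ?F. ?t A \<notin> \<Omega>p}"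
    proof clarify
      fix A assume A: "A \<in> strings ({..<n} - S)" "A \<noteq> id_str" "A \<notin> E"
      then have "?t A \<notin> ?acc" by (auto simp: E_def)
      \<comment> \<open>An extension in \<Omega>p has larger support, so it was visited before and,
        by the invariant, accepted.\<close>
      moreover have "?t A \<in> ?acc" if "?t A \<in> \<Omega>p"
      proof -
        have "?t A \<in> local_pairs n k"
          using that by (auto simp: \<Omega>p_def Omega_def local_pairs0_def)
        then have "?t A \<in> set ys" using card_gt[of A] A by (intro larger) auto
        with that acc(2) show ?thesis by blast
      qed
      ultimately show "A \<in> ?F \<and> ?t A \<notin> \<Omega>p" using A by blast
    qed
  qed (use finF in auto)
  also have "\<dots> \<le> \<rho>"
    unfolding \<rho>_def using sum_le_rho[OF Sn PS, of chi \<Omega>p] by simp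
  finally have outside: "cmod (\<Sum>A\<in>?F - E. ?chi A) \<le> \<rho>" .
  have each: "cmod (?chi A - estimate st (?t A)) \<le> bound (k - Suc (card S))" and le: "Suc (card S) \<le> k"
    if "A \<in> E" for A
  proof -
    have "?t A \<in> ?acc" "A \<in> ?F" using that by (auto simp: E_def)
    then have gt: "Suc (card S) \<le> card (supp2 (?t A))" using card_gt by (simp add: Suc_le_eq)
    have "?t A \<in> local_pairs n k"
      using \<open>?t A \<in> ?acc\<close> acc(1) by (auto simp: \<Omega>m_def Omega_def local_pairs0_def)
    then show "Suc (card S) \<le> k" using gt by (auto simp: local_pairs_def)
    have "cmod (?chi A - estimate st (?t A)) \<le> bound (k - card (supp2 (?t A)))"
      using inv \<open>?t A \<in> ?acc\<close> by (auto simp: invariant_def norm_minus_commute)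
    also have "\<dots> \<le> bound (k - Suc (card S))"
      using gt by (intro bound_mono er0) simp
    finally show "cmod (?chi A - estimate st (?t A)) \<le> bound (k - Suc (card S))" .
  qed
  have inside: "\<epsilon> + \<rho> + cmod (\<Sum>A\<in>E. ?chi A - estimate st (?t A)) \<le> bound (k - card S)"
  proof (cases "E = {}")
    case True
    then show ?thesis using bound_mono[OF er0, of 0 "k - card S"] by (simp add: bound_def)
  next
    case False
    then have "Suc (card S) \<le> k" using le by blast
    \<comment> \<open>An accepted extension has more than \<open>card S\<close> and at most
      \<open>k\<close> qubits, so the truncated difference is a successor and
      \<open>bound_Suc\<close> applies.\<close>
    then have k: "k - card S = Suc (k - Suc (card S))" by simp
    have "E \<subseteq> {A \<in> ?F. ?t A \<in> \<Omega>m}" using acc(1) by (auto simp: E_def)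
    then have "card E \<le> card {A \<in> ?F. ?t A \<in> \<Omega>m}" using finF by (intro card_mono) auto
    also have "\<dots> \<le> ddeg n \<Omega>m" using card_le_ddeg[OF Sn PS] .
    finally have "real (card E) \<le> d" by (simp add: d_def)
    have b0: "bound (k - Suc (card S)) \<ge> 0"
      unfolding bound_def by (intro mult_nonneg_nonneg sum_nonneg er0) (simp add: d_nonneg)
    have "cmod (\<Sum>A\<in>E. ?chi A - estimate st (?t A)) \<le> real (card E) * bound (k - Suc (card S))"
      by (rule order_trans[OF norm_sum sum_bounded_above]) (rule each)
    also have "\<dots> \<le> d * bound (k - Suc (card S))"
      using \<open>real (card E) \<le> d\<close> b0 by (rule mult_right_mono)
    finally show ?thesis unfolding k bound_Suc by simp
  qed
  have "cmod (tab (S, P, Q) - register st (S, P, Q) - chi P Q) \<le>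
      cmod (tab (S, P, Q) - (\<Sum>A\<in>strings ({..<n} - S). ?chi A)) +
      cmod (\<Sum>A\<in>E. ?chi A - estimate st (?t A)) + cmod (\<Sum>A\<in>?F - E. ?chi A)"
    unfolding split by (intro order_trans[OF norm_triangle_ineq] add_right_mono norm_triangle_ineq)
  then show "cmod (tab (S, P, Q) - register st (S, P, Q) - chi P Q) \<le> bound (k - card S)"
    using tab[OF valid] outside inside by linarith
qed

text \<open>The error bound of the visit, at most \<gamma>, decides whether the pair may be accepted
  or rejected, and \<open>result_visit\<close> shows that acceptance adds exactly the matching
  summand to each register.\<close>

lemma invariant_visit:
  assumes inv: "invariant ys st" and x: "x \<in> local_pairs n k" "1 \<le> card (supp2 x)" "x \<notin> set ys"
    and larger: "\<And>y. y \<in> local_pairs n k \<Longrightarrow> card (supp2 x) < card (supp2 y) \<Longrightarrow> y \<in> set ys"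
  shows "invariant (ys @ [x]) (result (visit lam tab x st))"
proof -
  obtain P Q where xPQ: "x = (P, Q)" by (cases x)
  define S where S: "S = supp P \<union> supp Q"
  have supp2: "supp2 x = S" by (simp add: xPQ supp2_def S)
  define v where "v = tab (S, P, Q) - register st (S, P, Q)"
  have finS: "finite S" and S0: "S \<noteq> {}" and cardS: "card S \<le> k"
    using x supp2 by (auto simp: local_pairs_def intro: card_ge_0_finite)
  have err: "cmod (v - chi P Q) \<le> bound (k - card S)" and er0: "\<epsilon> + \<rho> \<ge> 0"
    unfolding v_def
    using visit_error[OF inv, of P Q S] visit_eps[OF inv, of P Q S] x(1) S0 larger
    by (auto simp: xPQ S supp2_def)
  have err': "cmod (v - chi P Q) \<le> \<gamma>"
    using err bound_le_margin[OF er0, of "k - card S"] by simp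
  have x0: "x \<in> local_pairs0 n k"
    using x S0 by (auto simp: local_pairs0_def supp2 [symmetric] supp2_def supp_def id_str_def)
  \<comment> \<open>The first inequality puts an accepted pair into \<Omega>m, the second keeps a
    rejected pair out of \<Omega>p.\<close>
  have tri: "cmod v \<le> cmod (chi P Q) + \<gamma>" "cmod (chi P Q) \<le> cmod v + \<gamma>"
    using err' norm_triangle_ineq2[of v "chi P Q"] norm_triangle_ineq2[of "chi P Q" v]
    by (auto simp: norm_minus_commute)
  \<comment> \<open>Storing the estimate of \<open>x\<close> therefore leaves the old register sums
    unchanged.\<close>
  have xnot: "x \<notin> accepted st" using inv x(3) by (auto simp: invariant_def)
  have rv: "result (visit lam tab x st) =
    (if cmod v > lam
     then \<lparr>accepted = insert (P, Q) (accepted st), estimate = (estimate st)((P, Q) := v),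
           register = (\<lambda>r. register st r + (if extends r (P, Q) then v else 0))\<rparr>
     else st)"
    using result_visit[of P Q lam tab st, folded S, folded v_def] finS by (simp only: xPQ)
  show ?thesis
  proof (cases "cmod v > lam")
    case True
    let ?st = "\<lparr>accepted = insert x (accepted st), estimate = (estimate st)(x := v),
           register = (\<lambda>r. register st r + (if extends r x then v else 0))\<rparr>"
    have st: "result (visit lam tab x st) = ?st"
      using rv True by (simp add: xPQ)
    have "x \<in> \<Omega>m" using True tri x0 by (auto simp: \<Omega>m_def Omega_def xPQ)
    have fin: "finite (accepted st)" using inv by (auto simp: invariant_def intro: finite_subset)
    have reg: "register ?st r = (\<Sum>pq\<in>{pq \<in> accepted ?st. extends r pq}. estimate ?st pq)"
      if "valid_key n k r" for r
    proof -
      have "register st r = (\<Sum>pq\<in>{pq \<in> accepted st. extends r pq}. estimate st pq)"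
        using inv that unfolding invariant_def by blast
      also have "\<dots> = (\<Sum>pq\<in>{pq \<in> accepted st. extends r pq}. estimate ?st pq)"
        using xnot by (intro sum.cong) auto
      finally have old: "register st r = \<dots>" .
      show ?thesis
      proof (cases "extends r x")
        case True
        then have "{pq \<in> accepted ?st. extends r pq} = insert x {pq \<in> accepted st. extends r pq}"
          by auto
        then show ?thesis using True xnot fin old by (simp add: add.commute)
      next
        case False
        then have "{pq \<in> accepted ?st. extends r pq} = {pq \<in> accepted st. extends r pq}"
          by auto
        then show ?thesis using False old by simp
      qed
    qed
    have est: "cmod (estimate ?st (P', Q') - chi P' Q') \<le> bound (k - card (supp2 (P', Q')))"
      if "(P', Q') \<in> accepted ?st" for P' Q'
    proof (cases "(P', Q') = x")
      case True
      then show ?thesis using err supp2 by (simp add: xPQ)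
    next
      case False
      then show ?thesis using inv that by (auto simp: invariant_def)
    qed
    show ?thesis
      unfolding st invariant_def
    proof (intro conjI)
      show "accepted ?st \<subseteq> set (ys @ [x]) \<inter> \<Omega>m"
        using \<open>x \<in> \<Omega>m\<close> inv by (auto simp: invariant_def)
      show "set (ys @ [x]) \<inter> \<Omega>p \<subseteq> accepted ?st"
        using inv by (auto simp: invariant_def)
    qed (use est reg in blast)+
  next
    case False
    have st: "result (visit lam tab x st) = st"
      using rv False by simp
    have "x \<notin> \<Omega>p" using False tri by (auto simp: \<Omega>p_def Omega_def xPQ)
    then show ?thesis using inv unfolding st by (auto simp: invariant_def)
  qed
qed

lemma invariant_sweep:
  assumes order: "visit_order n k xs"
    and init: "accepted st0 = {}" "\<And>r. valid_key n k r \<Longrightarrow> register st0 r = 0"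
  shows "invariant xs (result (sweep lam tab xs st0))"
proof -
  \<comment> \<open>Induction over prefixes keeps the order of the whole list \<open>xs\<close>
    available.\<close>
  have "invariant ys (fold (\<lambda>x st. result (visit lam tab x st)) ys st0)" if "xs = ys @ zs" for ys zs
    using that
  proof (induction ys arbitrary: zs rule: rev_induct)
    case Nil
    then show ?case using init by (simp add: invariant_def)
  next
    case (snoc x ys)
    then have xs: "xs = ys @ x # zs" by simp
    have "invariant (ys @ [x]) (result (visit lam tab x (fold (\<lambda>x st. result (visit lam tab x st)) ys st0)))"
    proof (rule invariant_visit)
      show "invariant ys (fold (\<lambda>x st. result (visit lam tab x st)) ys st0)" using snoc.IH xs .
      have set: "set xs = {pq \<in> local_pairs n k. 1 \<le> card (supp2 pq)}" and "distinct xs"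
        and sorted: "sorted_wrt (\<lambda>x y. card (supp2 x) \<ge> card (supp2 y)) xs"
        using order by (auto simp: visit_order_def)
      then show "x \<in> local_pairs n k" "1 \<le> card (supp2 x)" "x \<notin> set ys"
        using xs by auto
      fix y assume y: "y \<in> local_pairs n k" "card (supp2 x) < card (supp2 y)"
      then have "y \<in> set xs" unfolding set by simp
      \<comment> \<open>Sizes do not increase along \<open>xs\<close>, so a strictly larger pair
        cannot stand at or after \<open>x\<close>.\<close>
      then show "y \<in> set ys" using y(2) sorted unfolding xs by (auto simp: sorted_wrt_append)
    qed
    then show ?case by simp
  qed
  then show ?thesis by (simp add: sweep_def)
qed

lemma sweep_correct:
  assumes "visit_order n k xs" "accepted st0 = {}" "\<And>r. valid_key n k r \<Longrightarrow> register st0 r = 0"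
  defines "st \<equiv> result (sweep lam tab xs st0)"
  shows "\<Omega>p \<subseteq> accepted st" "accepted st \<subseteq> \<Omega>m"
    and "\<forall>(P, Q)\<in>accepted st. cmod (estimate st (P, Q) - chi P Q) \<le> \<gamma>"
proof -
  have inv: "invariant xs st" unfolding st_def by (rule invariant_sweep) fact+
  have ne: "supp2 pq \<noteq> {} \<and> finite (supp2 pq)" if "pq \<in> local_pairs0 n k" for pq
    using that by (auto simp: local_pairs0_def local_pairs_def supp2_def finite_supp supp_empty_iff)
  have "\<Omega>p \<subseteq> set xs"
    using assms(1) ne by (auto simp: visit_order_def \<Omega>p_def Omega_def local_pairs0_def Suc_le_eq card_gt_0_iff)
  then show "\<Omega>p \<subseteq> accepted st" using inv by (auto simp: invariant_def)
  show "accepted st \<subseteq> \<Omega>m" using inv by (auto simp: invariant_def)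
  show "\<forall>(P, Q)\<in>accepted st. cmod (estimate st (P, Q) - chi P Q) \<le> \<gamma>"
  proof clarify
    fix P Q assume PQ: "(P, Q) \<in> accepted st"
    then have PQ0: "(P, Q) \<in> local_pairs0 n k"
      using \<open>accepted st \<subseteq> \<Omega>m\<close> by (auto simp: \<Omega>m_def Omega_def)
    let ?S = "supp P \<union> supp Q"
    have "valid_key n k (?S, P, Q)"
      using PQ0 ne[OF PQ0] by (auto simp: local_pairs0_def local_pairs_def valid_key_def strings_def supp2_def)
    \<comment> \<open>The accepted pair supplies a valid key, from which the sign of \<epsilon>
      follows.\<close>
    then have "\<epsilon> \<ge> 0" using order_trans[OF norm_ge_zero tab] by blast
    then have "\<epsilon> + \<rho> \<ge> 0" by (simp add: \<rho>_def rho_nonneg)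
    then show "cmod (estimate st (P, Q) - chi P Q) \<le> \<gamma>"
      using inv PQ bound_le_margin[of "k - card (supp2 (P, Q))"] by (fastforce simp: invariant_def)
  qed
qed

end

section \<open>The order of the exhaustive implementation\<close>

text \<open>Pascal's rule: a set of size \<open>Suc s\<close> below \<open>Suc m\<close> either
  contains \<open>m\<close> or lies below \<open>m\<close>, and the two kinds are disjoint.\<close>

lemma sized_subsets_correct:
  "set (result (sized_subsets m s)) = {S. S \<subseteq> {..<m} \<and> card S = s} \<and>
   distinct (result (sized_subsets m s)) \<and> length (result (sized_subsets m s)) = m choose s"
proof (induction m s rule: sized_subsets.induct)
  case (1 m)
  have "S = {}" if "S \<subseteq> {..<m}" "card S = 0" for S
    using that finite_subset[OF that(1)] by simp
  then show ?case by auto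
next
  case (3 m s)
  let ?A = "{S. S \<subseteq> {..<m} \<and> card S = s}" and ?B = "{S. S \<subseteq> {..<m} \<and> card S = Suc s}"
  have "{S. S \<subseteq> {..<Suc m} \<and> card S = Suc s} = insert m ` ?A \<union> ?B"
  proof (intro equalityI subsetI)
    fix S assume "S \<in> {S. S \<subseteq> {..<Suc m} \<and> card S = Suc s}"
    then have S: "S \<subseteq> insert m {..<m}" "card S = Suc s" by (simp_all add: lessThan_Suc)
    show "S \<in> insert m ` ?A \<union> ?B"
    proof (cases "m \<in> S")
      case True
      then have "S - {m} \<in> ?A" using S by auto
      then show ?thesis using True insert_Diff[OF True] by blast
    next
      case False
      then show ?thesis using S by blast
    qed
  next
    fix S assume "S \<in> insert m ` ?A \<union> ?B"
    then show "S \<in> {S. S \<subseteq> {..<Suc m} \<and> card S = Suc s}"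
    proof
      assume "S \<in> insert m ` ?A"
      then obtain T where T: "S = insert m T" "T \<subseteq> {..<m}" "card T = s" by blast
      then have "finite T" "m \<notin> T" using finite_subset[of T] by auto
      then show ?thesis using T by (simp add: lessThan_Suc subset_insertI2)
    qed (auto simp: lessThan_Suc)
  qed
  moreover have "inj_on (insert m) ?A" by (auto simp: inj_on_def)
  moreover have "insert m ` ?A \<inter> ?B = {}" by auto
  ultimately show ?case using 3
    by (simp only: sized_subsets.simps result_simps set_append set_map distinct_append distinct_map
        length_append length_map binomial_Suc_Suc)
qed simp

lemma length_all_subsets: "length (result (all_subsets qs)) = 2 ^ length qs"
proof (induction qs)
  case (Cons q qs)
  have "length (result (all_subsets (q # qs))) = 2 * length (result (all_subsets qs))"
    by (simp only: all_subsets.simps result_simps length_append length_map mult_2)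
  then show ?case by (simp only: Cons power_Suc list.size(4) add_Suc_right add_0_right)
qed simp

lemma all_strings_correct:
  "distinct qs \<Longrightarrow> set (result (all_strings qs)) = strings (set qs) \<and>
    distinct (result (all_strings qs)) \<and> length (result (all_strings qs)) = 4 ^ length qs"
proof (induction qs)
  case Nil
  then show ?case by (simp add: strings_empty)
next
  case (Cons q qs)
  let ?u = "\<lambda>(a, P). P(q := a)"
  \<comment> \<open>As the image of a product list under the bijection of
    \<open>strings_insert\<close>, the list inherits its set, distinctness and length.\<close>
  have eq: "result (all_strings (q # qs)) = map ?u (List.product [PI, PX, PY, PZ] (result (all_strings qs)))"
    by simp
  have bij: "bij_betw ?u (UNIV \<times> strings (set qs)) (strings (insert q (set qs)))"
    using Cons.prems by (intro strings_insert) simp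
  have IH: "set (result (all_strings qs)) = strings (set qs)" "distinct (result (all_strings qs))"
    "length (result (all_strings qs)) = 4 ^ length qs"
    using Cons by simp_all
  have letters: "set [PI, PX, PY, PZ] = UNIV" "distinct [PI, PX, PY, PZ]"
    by (simp_all add: UNIV_pauli)
  have set: "set (List.product [PI, PX, PY, PZ] (result (all_strings qs))) = UNIV \<times> strings (set qs)"
    by (simp only: set_product IH letters)
  have "distinct (List.product [PI, PX, PY, PZ] (result (all_strings qs)))"
    by (rule distinct_product[OF letters(2) IH(2)])
  moreover have "length (List.product [PI, PX, PY, PZ] (result (all_strings qs))) = 4 ^ length (q # qs)"
    by (simp only: length_product IH) simp
  ultimately show ?case
    unfolding eq distinct_map set_map set list.set(2) length_map
    using bij by (simp only: bij_betw_def)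
qed

lemma all_strings_sorted:
  assumes "finite S"
  shows "set (result (all_strings (sorted_list_of_set S))) = strings S"
    and "distinct (result (all_strings (sorted_list_of_set S)))"
    and "length (result (all_strings (sorted_list_of_set S))) = 4 ^ card S"
  using all_strings_correct[OF distinct_sorted_list_of_set[of S]] assms by simp_all

lemma card_strings:
  assumes "finite S"
  shows "card (strings S) = 4 ^ card S"
  using distinct_card[OF all_strings_sorted(2)[OF assms]] all_strings_sorted[OF assms] by simp

section \<open>Memory filled by the preparation\<close>

lemma fold_plus: "fold (\<lambda>x s. s + f x) xs s = s + sum_list (map f xs)"
  for s :: "'a::comm_monoid_add"
  by (induction xs arbitrary: s) (simp_all add: ac_simps)

lemma result_chi_hat_timed:
  assumes "finite S"
  shows "result (chi_hat_timed Lhat S P Q) = chi_hat Lhat S P Q"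
  by (simp add: chi_hat_timed_def chi_hat_def fold_plus sum_list_distinct_conv_sum_set
      all_strings_sorted[OF assms])

text \<open>A loop rule that nests: \<open>G K s\<close> says that the state \<open>s\<close> is
  right on the keys in \<open>K\<close>, and each iteration adds its own keys while preserving the
  earlier ones.\<close>

lemma fold_collect:
  assumes "\<And>x K s. x \<in> set xs \<Longrightarrow> G K s \<Longrightarrow> G (K \<union> F x) (f x s)" and "G K s"
  shows "G (K \<union> (\<Union>x\<in>set xs. F x)) (fold f xs s)"
  using assms
proof (induction xs arbitrary: K s)
  case (Cons x xs)
  have "G (K \<union> F x \<union> (\<Union>x\<in>set xs. F x)) (fold f xs (f x s))"
    using Cons.prems by (intro Cons.IH) auto
  then show ?case by (simp add: Un_assoc)
qed simp

lemma prepare_correct: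
  assumes "valid_key n k (S, P, Q)"
  shows "fst (result (prepare n k Lhat)) (S, P, Q) = chi_hat Lhat S P Q \<and>
    snd (result (prepare n k Lhat)) (S, P, Q) = 0"
proof -
  define G where "G K mem \<longleftrightarrow> (\<forall>(S, P, Q)\<in>K. fst mem (S, P, Q) = chi_hat Lhat S P Q \<and>
    snd mem (S, P, Q) = (0::complex))" for K and mem :: "(key \<Rightarrow> complex) \<times> (key \<Rightarrow> complex)"
  define Ps where "Ps S = result (all_strings (sorted_list_of_set S))" for S
  define step where "step = (\<lambda>S P Q (mem :: (key \<Rightarrow> complex) \<times> (key \<Rightarrow> complex)). result (case mem of (tab, reg) \<Rightarrow> do {
           c \<leftarrow> chi_hat_timed Lhat S P Q;
           tick (6 * (card S + 1));
           return (tab((S, P, Q) := c), reg((S, P, Q) := 0)) }))"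
  let ?K = "{} \<union> (\<Union>s\<in>set [1..<Suc k]. \<Union>S\<in>set (result (sized_subsets n s)).
    \<Union>P\<in>set (Ps S). \<Union>Q\<in>set (Ps S). {(S, P, Q)})"
  have step: "G (K \<union> {(S, P, Q)}) (step S P Q mem)" if "finite S" "G K mem" for S P Q K mem
  proof -
    have "step S P Q mem =
        ((fst mem)((S, P, Q) := chi_hat Lhat S P Q), (snd mem)((S, P, Q) := 0))"
      by (simp add: step_def case_prod_beta result_chi_hat_timed[OF that(1)])
    then show ?thesis using that(2) by (auto simp: G_def)
  qed
  have prepare: "result (prepare n k Lhat) = fold (\<lambda>s. fold (\<lambda>S. fold (\<lambda>P. fold (step S P) (Ps S)) (Ps S))
      (result (sized_subsets n s))) [1..<Suc k] (\<lambda>_. undefined, \<lambda>_. undefined)"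
    by (simp only: prepare_def result_for_each result_simps step_def Ps_def)
  have "G ?K (result (prepare n k Lhat))"
    unfolding prepare
  proof (rule fold_collect[where G = G])
    show "G {} (\<lambda>_. undefined, \<lambda>_. undefined)" by (simp add: G_def)
    fix s K mem assume G: "G K mem"
    show "G (K \<union> (\<Union>S\<in>set (result (sized_subsets n s)). \<Union>P\<in>set (Ps S). \<Union>Q\<in>set (Ps S). {(S, P, Q)}))
      (fold (\<lambda>S. fold (\<lambda>P. fold (step S P) (Ps S)) (Ps S)) (result (sized_subsets n s)) mem)"
    proof (rule fold_collect[where G = G])
      show "G K mem" by (rule G)
    next
      fix S K mem assume S: "S \<in> set (result (sized_subsets n s))" and G: "G K mem"
      then have "finite S" using sized_subsets_correct[of n s] finite_subset by auto
      then show "G (K \<union> (\<Union>P\<in>set (Ps S). \<Union>Q\<in>set (Ps S). {(S, P, Q)}))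
          (fold (\<lambda>P. fold (step S P) (Ps S)) (Ps S) mem)"
        by (intro fold_collect[where G = G] step G)
    qed
  qed
  moreover have "(S, P, Q) \<in> ?K"
  proof -
    have S: "S \<subseteq> {..<n}" "S \<noteq> {}" "card S \<le> k" "P \<in> strings S" "Q \<in> strings S"
      using assms by (simp_all add: valid_key_def)
    then have "finite S" using finite_subset by blast
    then have "card S \<in> set [1..<Suc k]" "P \<in> set (Ps S)" "Q \<in> set (Ps S)"
      using S by (simp_all add: Ps_def all_strings_sorted Suc_le_eq card_gt_0_iff del: upt_Suc)
    moreover have "S \<in> set (result (sized_subsets n (card S)))"
      using S by (simp add: sized_subsets_correct)
    ultimately show ?thesis by blast
  qed
  ultimately show ?thesis unfolding G_def by blast
qed

section \<open>Enumeration of the pairs of one level\<close>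

definition adds :: "('a list \<Rightarrow> 'a list) \<Rightarrow> 'a set \<Rightarrow> bool" where
  "adds f X \<longleftrightarrow> (\<forall>acc. distinct acc \<longrightarrow> set acc \<inter> X = {} \<longrightarrow>
     distinct (f acc) \<and> set (f acc) = set acc \<union> X)"

text \<open>Disjoint contributions of different iterations keep the accumulator free of duplicates;
  the conclusion has the form of the premise, so the rule nests.\<close>

lemma adds_fold:
  assumes "\<And>x. x \<in> set xs \<Longrightarrow> adds (f x) (X x)" "distinct xs"
    and "\<And>x y. x \<in> set xs \<Longrightarrow> y \<in> set xs \<Longrightarrow> x \<noteq> y \<Longrightarrow> X x \<inter> X y = {}"
  shows "adds (fold f xs) (\<Union>x\<in>set xs. X x)"
  using assms
proof (induction xs)
  case (Cons x xs)
  have IH: "adds (fold f xs) (\<Union>x\<in>set xs. X x)"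
    using Cons.prems by (intro Cons.IH) auto
  have "X x \<inter> (\<Union>y\<in>set xs. X y) = {}"
    using Cons.prems(2,3) by (fastforce simp: disjoint_iff)
  moreover have "adds (f x) (X x)" using Cons.prems by simp
  ultimately show ?case using IH unfolding adds_def
    by (simp add: Int_Un_distrib Int_Un_distrib2 Un_assoc)
qed (simp add: adds_def)

text \<open>Every pair is produced only at the set \<open>S\<close> that is its support union, so
  different \<open>S\<close> contribute disjoint sets.\<close>

lemma level_pairs_correct:
  "set (result (level_pairs n s)) = {pq \<in> strings {..<n} \<times> strings {..<n}. card (supp2 pq) = s} \<and>
   distinct (result (level_pairs n s))"
proof -
  let ?Ss = "result (sized_subsets n s)" and ?Ps = "\<lambda>S. result (all_strings (sorted_list_of_set S))"
  let ?X = "\<lambda>S P Q. if supp P \<union> supp Q = S then {(P, Q)} else {}"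
  have "adds (fold (\<lambda>S. fold (\<lambda>P. fold (\<lambda>Q acc. if supp P \<union> supp Q = S then (P, Q) # acc else acc)
        (?Ps S)) (?Ps S)) ?Ss)
     (\<Union>S\<in>set ?Ss. \<Union>P\<in>set (?Ps S). \<Union>Q\<in>set (?Ps S). ?X S P Q)"
  proof (rule adds_fold)
    fix S assume "S \<in> set ?Ss"
    then have "finite S" using sized_subsets_correct[of n s] finite_subset by auto
    then show "adds (fold (\<lambda>P. fold (\<lambda>Q acc. if supp P \<union> supp Q = S then (P, Q) # acc else acc)
        (?Ps S)) (?Ps S)) (\<Union>P\<in>set (?Ps S). \<Union>Q\<in>set (?Ps S). ?X S P Q)"
      by (intro adds_fold) (auto simp: all_strings_sorted adds_def)
  qed (auto simp: sized_subsets_correct split: if_splits)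
  from this[unfolded adds_def, rule_format, of "[]"]
  have "distinct (result (level_pairs n s)) \<and> set (result (level_pairs n s)) =
      (\<Union>S\<in>set ?Ss. \<Union>P\<in>set (?Ps S). \<Union>Q\<in>set (?Ps S). ?X S P Q)"
    by (simp add: level_pairs_def)
  moreover have "(\<Union>S\<in>set ?Ss. \<Union>P\<in>set (?Ps S). \<Union>Q\<in>set (?Ps S). ?X S P Q) =
      {pq \<in> strings {..<n} \<times> strings {..<n}. card (supp2 pq) = s}"
  proof (intro equalityI subsetI)
    fix pq assume "pq \<in> (\<Union>S\<in>set ?Ss. \<Union>P\<in>set (?Ps S). \<Union>Q\<in>set (?Ps S). ?X S P Q)"
    then show "pq \<in> {pq \<in> strings {..<n} \<times> strings {..<n}. card (supp2 pq) = s}"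
      by (auto simp: sized_subsets_correct strings_def supp2_def split: if_splits)
  next
    fix pq assume "pq \<in> {pq \<in> strings {..<n} \<times> strings {..<n}. card (supp2 pq) = s}"
    then obtain P Q where PQ: "pq = (P, Q)" "P \<in> strings {..<n}" "Q \<in> strings {..<n}"
      "card (supp P \<union> supp Q) = s" by (auto simp: supp2_def)
    let ?S = "supp P \<union> supp Q"
    have "?S \<in> set ?Ss" using PQ by (auto simp: sized_subsets_correct strings_def)
    moreover have "P \<in> set (?Ps ?S)" "Q \<in> set (?Ps ?S)"
      using PQ finite_supp by (auto simp: all_strings_sorted) (auto simp: strings_def)
    ultimately show "pq \<in> (\<Union>S\<in>set ?Ss. \<Union>P\<in>set (?Ps S). \<Union>Q\<in>set (?Ps S). ?X S P Q)"
      unfolding PQ(1) by force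
  qed
  ultimately show ?thesis by simp
qed

section \<open>Concatenation of the levels into one sweep\<close>

definition exhaustive_order :: "nat \<Rightarrow> nat \<Rightarrow> (pstring \<times> pstring) list" where
  "exhaustive_order n k = concat (map (\<lambda>s. result (level_pairs n s)) (rev [1..<Suc k]))"

text \<open>\<open>f\<close> is constant on each level and strictly decreases from level to level,
  which gives both the order and the disjointness of the levels.\<close>

lemma sorted_wrt_levels:
  fixes f :: "'a \<Rightarrow> nat"
  assumes "sorted_wrt (>) ls" and "\<And>s x. s \<in> set ls \<Longrightarrow> x \<in> set (lev s) \<Longrightarrow> f x = s"
    and "\<And>s. s \<in> set ls \<Longrightarrow> distinct (lev s)"
  shows "sorted_wrt (\<lambda>x y. f x \<ge> f y) (concat (map lev ls)) \<and> distinct (concat (map lev ls))"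
  using assms
proof (induction ls)
  case (Cons s ls)
  have IH: "sorted_wrt (\<lambda>x y. f x \<ge> f y) (concat (map lev ls)) \<and> distinct (concat (map lev ls))"
    using Cons.prems by (intro Cons.IH) auto
  have less: "f y < s" if "y \<in> set (concat (map lev ls))" for y
    using Cons.prems(1,2) that by auto
  have "sorted_wrt (\<lambda>x y. f x \<ge> f y) (lev s)"
    using Cons.prems(2)[of s] by (auto simp: sorted_wrt_iff_nth_less)
  moreover have eq: "f x = s" if "x \<in> set (lev s)" for x using Cons.prems(2)[of s] that by simp
  moreover have "set (lev s) \<inter> set (concat (map lev ls)) = {}"
    using less eq less_irrefl[of s] by blast
  moreover have "distinct (lev s)" using Cons.prems(3) by simp
  ultimately show ?case using IH less
    by (simp add: sorted_wrt_append less_imp_le del: set_concat)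
qed simp

lemma visit_order_exhaustive: "visit_order n k (exhaustive_order n k)"
proof -
  have "sorted_wrt (\<lambda>x y. y < x) (rev [1..<Suc k])"
    by (simp add: sorted_wrt_rev del: upt_Suc)
  then have "sorted_wrt (\<lambda>x y. card (supp2 x) \<ge> card (supp2 y)) (exhaustive_order n k) \<and>
      distinct (exhaustive_order n k)"
    unfolding exhaustive_order_def
    by (rule sorted_wrt_levels) (auto simp: level_pairs_correct)
  moreover have "set (exhaustive_order n k) = {pq \<in> local_pairs n k. 1 \<le> card (supp2 pq)}"
    by (auto simp: exhaustive_order_def level_pairs_correct local_pairs_def simp del: upt_Suc)
  ultimately show ?thesis by (simp add: visit_order_def)
qed

lemma fold_levels: "fold (\<lambda>s st. fold f (lev s) st) ls st = fold f (concat (map lev ls)) st"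
  by (induction ls arbitrary: st) simp_all

text \<open>Level by level processing is a single sweep over \<open>exhaustive_order\<close>, so the
  analysis of \<open>sweep\<close> applies.\<close>

lemma result_exhaustive_recovery:
  "result (exhaustive_recovery n k lam Lhat) =
   result (sweep lam (fst (result (prepare n k Lhat))) (exhaustive_order n k)
     \<lparr>accepted = {}, estimate = (\<lambda>_. 0), register = snd (result (prepare n k Lhat))\<rparr>)"
  by (simp add: exhaustive_recovery_def sweep_def exhaustive_order_def fold_levels case_prod_beta
      del: upt_Suc)

lemma recovery_correct:
  assumes chi: "chi_coeffs n L chi"
    and close: "\<forall>S. S \<subseteq> {..<n} \<and> S \<noteq> {} \<and> card S \<le> k \<longrightarrow>
         (\<forall>A\<in>strings S. \<forall>B\<in>strings S. cmod (Lhat A B - ptm n L A B) \<le> \<epsilon>)"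
    and margin: "(\<Sum>l=0..k. real (ddeg n (Omega n k chi (lam - \<gamma>))) ^ l) *
      (\<epsilon> + rho n chi (Omega n k chi (lam + \<gamma>))) \<le> \<gamma>"
    and st: "(\<exists>xs. visit_order n k xs \<and> st = guarded_recovery lam Lhat xs) \<or>
      st = result (exhaustive_recovery n k lam Lhat)"
  shows "Omega n k chi (lam + \<gamma>) \<subseteq> accepted st" "accepted st \<subseteq> Omega n k chi (lam - \<gamma>)"
    and "\<forall>(P, Q)\<in>accepted st. cmod (estimate st (P, Q) - chi P Q) \<le> \<gamma>"
proof -
  \<comment> \<open>Both programs are sweeps in an admissible order, with a table equal to
    \<open>chi_hat\<close> and registers equal to 0 at valid keys.\<close>
  obtain tab xs st0 where st: "st = result (sweep lam tab xs st0)" and order: "visit_order n k xs"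
    and init: "accepted st0 = {}" "\<And>r. valid_key n k r \<Longrightarrow> register st0 r = 0"
    and tab: "\<And>S P Q. valid_key n k (S, P, Q) \<Longrightarrow> tab (S, P, Q) = chi_hat Lhat S P Q"
    using st
  proof (elim disjE exE conjE)
    fix xs assume "visit_order n k xs" "st = guarded_recovery lam Lhat xs"
    then show thesis by (intro that) (auto simp: guarded_recovery_def)
  next
    assume "st = result (exhaustive_recovery n k lam Lhat)"
    then show thesis unfolding result_exhaustive_recovery
      by (rule that) (auto simp: visit_order_exhaustive prepare_correct)
  qed
  interpret guarded_sweep n k chi lam \<gamma> \<epsilon> tab "Omega n k chi (lam - \<gamma>)" "Omega n k chi (lam + \<gamma>)"
    "real (ddeg n (Omega n k chi (lam - \<gamma>)))" "rho n chi (Omega n k chi (lam + \<gamma>))"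
  proof
    fix S P Q assume valid: "valid_key n k (S, P, Q)"
    then have S: "S \<subseteq> {..<n}" "S \<noteq> {}" "card S \<le> k" "P \<in> strings S" "Q \<in> strings S"
      by (auto simp: valid_key_def)
    have "cmod (chi_hat Lhat S P Q - chi_hat (ptm n L) S P Q) \<le> \<epsilon>"
      using close S finite_subset[OF S(1)] by (intro chi_hat_perturbation) auto
    then show "cmod (tab (S, P, Q) - (\<Sum>A\<in>strings ({..<n} - S). chi (tensor S P A) (tensor S Q A))) \<le> \<epsilon>"
      using tab[OF valid] chi_hat_ptm[OF chi S(1,4,5)] by simp
  qed (use margin in simp_all)
  show "Omega n k chi (lam + \<gamma>) \<subseteq> accepted st" "accepted st \<subseteq> Omega n k chi (lam - \<gamma>)"
    "\<forall>(P, Q)\<in>accepted st. cmod (estimate st (P, Q) - chi P Q) \<le> \<gamma>"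
    unfolding st using sweep_correct[OF order init] by blast+
qed

section \<open>Running time\<close>

lemma cost_simps [simp]:
  "cost (return x) = 0"
  "cost (bind_timed c f) = cost c + cost (f (result c))"
  "cost (tick t) = t"
  by (simp_all add: return_def bind_timed_def tick_def)

lemma cost_for_each:
  assumes "\<And>x s. x \<in> set xs \<Longrightarrow> cost (f x s) \<le> c"
  shows "cost (for_each xs f s) \<le> 1 + length xs * (c + 1)"
  using assms
proof (induction xs arbitrary: s)
  case (Cons x xs)
  have "cost (for_each xs f (result (f x s))) \<le> 1 + length xs * (c + 1)"
    using Cons.prems by (intro Cons.IH) simp
  moreover have "cost (f x s) \<le> c" using Cons.prems by simp
  ultimately show ?case by simp
qed simp

lemma binomial_le_power: "m choose s \<le> m ^ s"
  by (cases "s \<le> m") (simp_all add: binomial_le_pow binomial_eq_0)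

text \<open>The recursion preserves the bound since (m+1)^(s+1) + (m+1)^s = (m+2) (m+1)^s \<le>
  (m+2)^(s+1), while the growth of the prefactor absorbs the copying cost. The base m+1 leaves room
  for the unit charged at m = 0.\<close>

lemma cost_sized_subsets: "cost (sized_subsets m s) \<le> (s + 1) * (s + 3) * (m + 1) ^ s"
proof (induction m s rule: sized_subsets.induct)
  case (3 m s)
  let ?p = "(m + 1) ^ s"
  have "length (result (sized_subsets m s)) \<le> m ^ s"
    using sized_subsets_correct[of m s] binomial_le_power[of m s] by simp
  also have "\<dots> \<le> ?p" by (rule power_mono) simp_all
  finally have len: "(s + 2) * length (result (sized_subsets m s)) \<le> (s + 2) * ?p"
    by (rule mult_left_mono) simp
  have "cost (sized_subsets (Suc m) (Suc s)) = cost (sized_subsets m s) +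
      (cost (sized_subsets m (Suc s)) + (1 + (s + 2) * length (result (sized_subsets m s))))"
    by simp
  also have "\<dots> \<le> (s + 1) * (s + 3) * ?p + ((s + 2) * (s + 4) * (m + 1) ^ Suc s + (?p + (s + 2) * ?p))"
  proof (intro add_mono)
    have "Suc s + 1 = s + 2" "Suc s + 3 = s + 4" by simp_all
    then show "cost (sized_subsets m (Suc s)) \<le> (s + 2) * (s + 4) * (m + 1) ^ Suc s"
      using 3(2) by (simp only:)
  qed (use 3(1) len in simp_all)
  also have "\<dots> \<le> (s + 2) * (s + 4) * ((m + 1) ^ Suc s + ?p)"
    by (simp add: algebra_simps)
  also have "(m + 1) ^ Suc s + ?p = (m + 2) * ?p"
    by (simp add: algebra_simps)
  also have "(s + 2) * (s + 4) * ((m + 2) * ?p) \<le> (s + 2) * (s + 4) * ((m + 2) * (m + 2) ^ s)"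
    by (intro mult_left_mono power_mono) simp_all
  finally have "cost (sized_subsets (Suc m) (Suc s)) \<le> (s + 2) * (s + 4) * (m + 2) ^ Suc s"
    by (simp only: power_Suc)
  moreover have "Suc s + 1 = s + 2" "Suc s + 3 = s + 4" "Suc m + 1 = m + 2" by simp_all
  ultimately show ?case by (simp only:)
qed simp_all

definition sized_const :: "nat \<Rightarrow> nat" where
  "sized_const s = (s + 1) * (s + 3) * 2 ^ s"

text \<open>For \<open>n \<ge> 1\<close> the base \<open>n + 1\<close> is at most
  \<open>2 * n\<close>, which costs the factor \<open>2 ^ s\<close> in
  \<open>sized_const\<close>.\<close>

lemma cost_sized_subsets_power:
  assumes "n \<ge> 1"
  shows "cost (sized_subsets n s) \<le> sized_const s * n ^ s"
proof -
  have "(n + 1) ^ s \<le> (2 * n) ^ s"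
    using assms by (intro power_mono) simp_all
  then have "(s + 1) * (s + 3) * (n + 1) ^ s \<le> (s + 1) * (s + 3) * (2 ^ s * n ^ s)"
    unfolding power_mult_distrib by (rule mult_left_mono) simp
  with cost_sized_subsets[of n s] show ?thesis
    unfolding sized_const_def mult.assoc by (rule order_trans)
qed

primrec subsets_cost :: "nat \<Rightarrow> nat" where
  "subsets_cost 0 = 1"
| "subsets_cost (Suc l) = subsets_cost l + (1 + 2 * (l + 2) * 2 ^ l)"

lemma cost_all_subsets: "cost (all_subsets qs) = subsets_cost (length qs)"
  by (induction qs) (simp_all add: length_all_subsets)

primrec strings_cost :: "nat \<Rightarrow> nat" where
  "strings_cost 0 = 1"
| "strings_cost (Suc l) = strings_cost l + (1 + 4 * (l + 2) * 4 ^ l)"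

lemma cost_all_strings: "distinct qs \<Longrightarrow> cost (all_strings qs) = strings_cost (length qs)"
  by (induction qs) (simp_all add: all_strings_correct)

lemma cost_string_pairs:
  assumes "finite S" and "\<And>P Q s. cost (f P Q s) \<le> c"
  shows "cost (bind_timed (all_strings (sorted_list_of_set S)) (\<lambda>Ps. for_each Ps (\<lambda>P. for_each Ps (f P)) s)) \<le>
    strings_cost (card S) + (1 + 4 ^ card S * ((1 + 4 ^ card S * (c + 1)) + 1))"
proof -
  let ?Ps = "result (all_strings (sorted_list_of_set S))"
  have inner: "cost (for_each ?Ps (f P) s) \<le> 1 + 4 ^ card S * (c + 1)" for P s
    using cost_for_each[of ?Ps "f P" c s] assms by (simp add: all_strings_sorted(3))
  have "cost (for_each ?Ps (\<lambda>P. for_each ?Ps (f P)) s) \<le> 1 + 4 ^ card S * ((1 + 4 ^ card S * (c + 1)) + 1)"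
    using cost_for_each[of ?Ps "\<lambda>P. for_each ?Ps (f P)", OF inner] all_strings_sorted(3)[OF assms(1)]
    by metis
  then show ?thesis using assms(1) by (simp add: cost_all_strings)
qed

definition pair_loop_const :: "nat \<Rightarrow> nat \<Rightarrow> nat" where
  "pair_loop_const s c = strings_cost s + (1 + 4 ^ s * ((1 + 4 ^ s * (c + 1)) + 1))"

definition chi_hat_const :: "nat \<Rightarrow> nat" where
  "chi_hat_const s = pair_loop_const s (2 * (s + 1) + trace_cost s + 3) + (3 * s + 1)"

lemma cost_chi_hat_timed:
  assumes "finite S"
  shows "cost (chi_hat_timed Lhat S P Q) \<le> chi_hat_const (card S)"
  using cost_string_pairs[OF assms, where c = "2 * (card S + 1) + trace_cost (card S) + 3" and s = 0 and
      f = "\<lambda>A B x. do {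
            tick (2 * (card S + 1) + trace_cost (card S) + 3);
            return (x + Lhat A B *
              mtrace (pmat_on S A * pmat_on S Q * pmat_on S B * pmat_on S P)) }"]
  by (simp add: chi_hat_timed_def chi_hat_const_def pair_loop_const_def)

text \<open>Every phase of the algorithm is a loop over the \<open>n choose s\<close> sets of size \<open>s\<close> whose body has a
  cost depending on \<open>s\<close> only.\<close>

definition subset_loop_const :: "nat \<Rightarrow> nat \<Rightarrow> nat" where
  "subset_loop_const s c = sized_const s + 1 + (c + 1)"

lemma cost_subset_loop:
  assumes n: "n \<ge> 1"
    and body: "\<And>S st. S \<subseteq> {..<n} \<Longrightarrow> card S = s \<Longrightarrow> finite S \<Longrightarrow> cost (f S st) \<le> c"
  shows "cost (bind_timed (sized_subsets n s) (\<lambda>Ss. for_each Ss f st)) \<le> subset_loop_const s c * n ^ s"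
proof -
  let ?Ss = "result (sized_subsets n s)"
  have "cost (for_each ?Ss f st) \<le> 1 + length ?Ss * (c + 1)"
    using body sized_subsets_correct[of n s] finite_subset by (intro cost_for_each) auto
  also have "\<dots> \<le> n ^ s + n ^ s * (c + 1)"
    using n sized_subsets_correct[of n s] binomial_le_power[of n s]
    by (intro add_mono mult_right_mono) simp_all
  finally have "cost (for_each ?Ss f st) \<le> n ^ s + n ^ s * (c + 1)" .
  with cost_sized_subsets_power[OF n, of s] show ?thesis
    by (simp add: subset_loop_const_def algebra_simps)
qed

text \<open>Each of the \<open>k\<close> levels is bounded by the worst power \<open>n ^ k\<close>
  and by the sum of all constants, so the resulting constant depends on \<open>k\<close> and
  \<open>c\<close> only.\<close>

lemma cost_level_loop:
  assumes n: "n \<ge> 1"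
    and body: "\<And>s st. 1 \<le> s \<Longrightarrow> s \<le> k \<Longrightarrow> cost (f s st) \<le> c s * n ^ s"
    and xs: "set xs = {1..k}" "length xs = k"
  shows "cost (for_each xs f st) \<le> (1 + k * (sum c {1..k} + 1)) * n ^ k"
proof -
  have "cost (f s st) \<le> sum c {1..k} * n ^ k" if "s \<in> set xs" for s st
  proof -
    have s: "s \<in> {1..k}" using that xs by simp
    then have "cost (f s st) \<le> c s * n ^ s" using body by simp
    also have "\<dots> \<le> sum c {1..k} * n ^ k"
      using s n by (intro mult_mono power_increasing member_le_sum) auto
    finally show ?thesis .
  qed
  then have "cost (for_each xs f st) \<le> 1 + k * (sum c {1..k} * n ^ k + 1)"
    using cost_for_each[of xs f "sum c {1..k} * n ^ k" st] xs(2) by simp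
  also have "\<dots> \<le> n ^ k + k * (sum c {1..k} * n ^ k + n ^ k)"
    using n by (intro add_mono mult_left_mono) simp_all
  also have "\<dots> = (1 + k * (sum c {1..k} + 1)) * n ^ k" by (simp add: algebra_simps)
  finally show ?thesis .
qed

section \<open>Costs of preparation, levels and visits\<close>

definition prepare_const :: "nat \<Rightarrow> nat" where
  "prepare_const s = subset_loop_const s (pair_loop_const s (chi_hat_const s + 6 * (s + 1)))"

lemma cost_prepare:
  assumes "n \<ge> 1"
  shows "cost (prepare n k Lhat) \<le> (1 + k * (sum prepare_const {1..k} + 1)) * n ^ k"
  unfolding prepare_def
proof (rule cost_level_loop[OF assms])
  show "set [1..<Suc k] = {1..k}" "length [1..<Suc k] = k" by auto
  fix s mem
  show "cost (do {
       Ss \<leftarrow> sized_subsets n s;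
       for_each Ss (\<lambda>S mem. do {
         Ps \<leftarrow> all_strings (sorted_list_of_set S);
         for_each Ps (\<lambda>P. for_each Ps (\<lambda>Q (tab, reg). do {
           c \<leftarrow> chi_hat_timed Lhat S P Q;
           tick (6 * (card S + 1));
           return (tab((S, P, Q) := c), reg((S, P, Q) := 0)) })) mem }) mem }) \<le> prepare_const s * n ^ s"
    unfolding prepare_const_def
  proof (rule cost_subset_loop[OF assms])
    fix S :: "nat set" and mem assume S: "card S = s" "finite S"
    show "cost (do {
         Ps \<leftarrow> all_strings (sorted_list_of_set S);
         for_each Ps (\<lambda>P. for_each Ps (\<lambda>Q (tab, reg). do {
           c \<leftarrow> chi_hat_timed Lhat S P Q;
           tick (6 * (card S + 1));
           return (tab((S, P, Q) := c), reg((S, P, Q) := 0)) })) mem }) \<le>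
        pair_loop_const s (chi_hat_const s + 6 * (s + 1))"
      unfolding pair_loop_const_def S(1)[symmetric]
      by (rule cost_string_pairs[OF S(2)])
        (simp add: case_prod_beta cost_chi_hat_timed[OF S(2)])
  qed
qed

definition level_const :: "nat \<Rightarrow> nat" where
  "level_const s = subset_loop_const s (pair_loop_const s (3 * (s + 1)))"

lemma cost_level_pairs:
  assumes "n \<ge> 1"
  shows "cost (level_pairs n s) \<le> level_const s * n ^ s"
  unfolding level_pairs_def level_const_def
proof (rule cost_subset_loop[OF assms])
  fix S :: "nat set" and xs assume S: "card S = s" "finite S"
  show "cost (do {
       Ps \<leftarrow> all_strings (sorted_list_of_set S);
       for_each Ps (\<lambda>P. for_each Ps (\<lambda>Q xs. do {
         tick (3 * (card S + 1));
         return (if supp P \<union> supp Q = S then (P, Q) # xs else xs) })) xs }) \<le> pair_loop_const s (3 * (s + 1))"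
    unfolding pair_loop_const_def S(1)[symmetric] by (rule cost_string_pairs[OF S(2)]) simp
qed

text \<open>Each pair consists of strings on its support union; there are at most
  \<open>n ^ s\<close> such sets and \<open>16 ^ s\<close> pairs of strings on each.\<close>

lemma length_level_pairs: "length (result (level_pairs n s)) \<le> 16 ^ s * n ^ s"
proof -
  let ?A = "{S. S \<subseteq> {..<n} \<and> card S = s}"
  have fin: "finite S" if "S \<in> ?A" for S using that finite_subset by auto
  have "length (result (level_pairs n s)) = card {pq \<in> strings {..<n} \<times> strings {..<n}. card (supp2 pq) = s}"
    using distinct_card[OF conjunct2[OF level_pairs_correct[of n s]]] level_pairs_correct[of n s] by simp
  also have "\<dots> \<le> card (\<Union>S\<in>?A. strings S \<times> strings S)"
  proof (rule card_mono)
    show "finite (\<Union>S\<in>?A. strings S \<times> strings S)"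
      by (intro finite_UN_I finite_cartesian_product finite_strings fin) simp_all
    show "{pq \<in> strings {..<n} \<times> strings {..<n}. card (supp2 pq) = s} \<subseteq> (\<Union>S\<in>?A. strings S \<times> strings S)"
    proof (rule subsetI)
      fix pq assume pq: "pq \<in> {pq \<in> strings {..<n} \<times> strings {..<n}. card (supp2 pq) = s}"
      obtain P Q where PQ: "pq = (P, Q)" by (cases pq)
      from pq have "supp P \<union> supp Q \<in> ?A" "P \<in> strings (supp P \<union> supp Q)" "Q \<in> strings (supp P \<union> supp Q)"
        by (simp_all add: strings_def supp2_def PQ)
      then show "pq \<in> (\<Union>S\<in>?A. strings S \<times> strings S)" unfolding PQ by blast
    qed
  qed
  also have "\<dots> \<le> (\<Sum>S\<in>?A. card (strings S \<times> strings S))"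
    by (rule card_UN_le) simp
  also have "\<dots> = (\<Sum>S\<in>?A. 16 ^ s)"
  proof (rule sum.cong)
    fix S assume S: "S \<in> ?A"
    then have "card (strings S \<times> strings S) = (4 * 4) ^ s"
      using card_strings[OF fin[OF S]] by (simp only: card_cartesian_product power_mult_distrib) simp
    then show "card (strings S \<times> strings S) = 16 ^ s" by simp
  qed simp
  also have "\<dots> = (n choose s) * 16 ^ s"
    using n_subsets[of "{..<n}" s] by simp
  also have "\<dots> \<le> n ^ s * 16 ^ s"
    by (rule mult_right_mono[OF binomial_le_power]) simp
  finally show ?thesis by (simp add: mult.commute)
qed

definition visit_const :: "nat \<Rightarrow> nat" where
  "visit_const s = 3 * (s + 1) + 2 + (2 * (s + 1) + (subsets_cost s + (1 + 2 ^ s * (6 * (s + 1) + 1 + 1))))"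

text \<open>Acceptance is the expensive branch; it runs through all \<open>2 ^ card S\<close>
  subsets of the support union.\<close>

lemma cost_visit:
  assumes "finite (supp2 pq)"
  shows "cost (visit lam tab pq st) \<le> visit_const (card (supp2 pq))"
proof -
  obtain P Q where pq: "pq = (P, Q)" by (cases pq)
  define S where S: "S = supp P \<union> supp Q"
  have supp2: "supp2 pq = S" by (simp add: pq supp2_def S)
  define v where "v = tab (S, restr S P, restr S Q) - register st (S, restr S P, restr S Q)"
  define f where "f = (\<lambda>T (st' :: rec_state). do {
            tick (3 * (card S + 1));
            if T \<noteq> {} \<and> T \<subset> S \<and> restr (S - T) P = restr (S - T) Q then do {
              let r = (T, restr T P, restr T Q);
              tick (3 * (card S + 1) + 1);
              return (st'\<lparr>register := (register st')(r := register st' r + v)\<rparr>)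
            } else return st' })"
  have f: "cost (f T st') \<le> 6 * (card S + 1) + 1" for T st'
    by (simp add: f_def Let_def)
  let ?Ts = "result (all_subsets (sorted_list_of_set S))"
  have "length ?Ts = 2 ^ card S" by (simp add: length_all_subsets)
  then have loop: "cost (for_each ?Ts f st') \<le> 1 + 2 ^ card S * (6 * (card S + 1) + 1 + 1)" for st'
    using cost_for_each[of ?Ts f "6 * (card S + 1) + 1", OF f] by metis
  have "cost (visit lam tab pq st) = 3 * (card S + 1) + 2 + (if cmod v > lam then
      2 * (card S + 1) + (subsets_cost (card S) + cost (for_each ?Ts f
        (st\<lparr>accepted := insert (P, Q) (accepted st), estimate := (estimate st)((P, Q) := v)\<rparr>))) else 0)"
    unfolding pq visit_def prod.case Let_def S[symmetric] v_def[symmetric]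
    by (simp add: f_def Let_def cost_all_subsets if_distrib[where f = cost] cong: if_cong)
  then show ?thesis
    using loop unfolding supp2 visit_const_def by (auto intro!: add_mono)
qed

definition round_const :: "nat \<Rightarrow> nat" where
  "round_const s = level_const s + 1 + 16 ^ s * (visit_const s + 1)"

lemma cost_round:
  assumes n: "n \<ge> 1"
  shows "cost (bind_timed (level_pairs n s) (\<lambda>xs. sweep lam tab xs st)) \<le> round_const s * n ^ s"
proof -
  let ?xs = "result (level_pairs n s)"
  have visit: "cost (visit lam tab pq st) \<le> visit_const s" if "pq \<in> set ?xs" for pq st
  proof -
    have "finite (supp2 pq)" "card (supp2 pq) = s"
      using that by (auto simp: level_pairs_correct supp2_def finite_supp)
    then show ?thesis using cost_visit[of pq lam tab st] by simp
  qed
  have "cost (sweep lam tab ?xs st) \<le> 1 + length ?xs * (visit_const s + 1)"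
    unfolding sweep_def by (rule cost_for_each) (rule visit)
  also have "\<dots> \<le> n ^ s + 16 ^ s * n ^ s * (visit_const s + 1)"
    using n by (intro add_mono mult_right_mono length_level_pairs) simp_all
  finally show ?thesis
    using cost_level_pairs[OF n, of s] by (simp add: round_const_def algebra_simps)
qed

definition runtime_const :: "nat \<Rightarrow> nat" where
  "runtime_const k = (1 + k * (sum prepare_const {1..k} + 1)) + (1 + k * (sum round_const {1..k} + 1))"

lemma cost_exhaustive_recovery:
  assumes n: "n \<ge> 1"
  shows "cost (exhaustive_recovery n k lam Lhat) \<le> runtime_const k * n ^ k"
proof -
  have "cost (for_each (rev [1..<Suc k]) (\<lambda>s st. do { xs \<leftarrow> level_pairs n s; sweep lam tab xs st }) st) \<le>
      (1 + k * (sum round_const {1..k} + 1)) * n ^ k" for tab st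
    by (rule cost_level_loop[OF n]) (use cost_round[OF n] in auto)
  moreover have "cost (prepare n k Lhat) \<le> (1 + k * (sum prepare_const {1..k} + 1)) * n ^ k"
    by (rule cost_prepare[OF n])
  ultimately show ?thesis
    unfolding exhaustive_recovery_def runtime_const_def add_mult_distrib
    by (simp add: case_prod_beta add_mono del: upt_Suc)
qed

text \<open>Bounds the number of accepted pairs: they all occur in \<open>exhaustive_order\<close>,
  which has \<open>k\<close> levels of at most \<open>16 ^ k * n ^ k\<close> entries.\<close>

lemma card_local_pairs:
  assumes n: "n \<ge> 1" and A: "A \<subseteq> local_pairs0 n k"
  shows "card A \<le> k * 16 ^ k * n ^ k"
proof -
  have len: "length (exhaustive_order n k) \<le> k * (16 ^ k * n ^ k)"
  proof -
    have "length (exhaustive_order n k) = (\<Sum>s\<leftarrow>rev [1..<Suc k]. length (result (level_pairs n s)))"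
      by (simp add: exhaustive_order_def length_concat comp_def del: upt_Suc)
    also have "\<dots> \<le> (\<Sum>s\<leftarrow>rev [1..<Suc k]. 16 ^ k * n ^ k)"
    proof (rule sum_list_mono)
      fix s assume "s \<in> set (rev [1..<Suc k])"
      then have "16 ^ s * n ^ s \<le> 16 ^ k * n ^ k"
        using n by (intro mult_mono power_increasing) auto
      then show "length (result (level_pairs n s)) \<le> 16 ^ k * n ^ k"
        using length_level_pairs[of n s] by (rule order_trans[rotated])
    qed
    also have "\<dots> = k * (16 ^ k * n ^ k)" by (simp add: sum_list_triv del: upt_Suc)
    finally show ?thesis .
  qed
  have "1 \<le> card (supp2 pq)" if "pq \<in> local_pairs0 n k" for pq
    using that by (auto simp: local_pairs0_def local_pairs_def supp2_def Suc_le_eq card_gt_0_iff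
        finite_supp supp_empty_iff)
  then have "A \<subseteq> set (exhaustive_order n k)"
    using A visit_order_exhaustive[of n k] by (auto simp: visit_order_def local_pairs0_def)
  then have "card A \<le> card (set (exhaustive_order n k))" by (rule card_mono[rotated]) simp
  also have "\<dots> \<le> length (exhaustive_order n k)" by (rule card_length)
  finally show ?thesis using len by (simp add: mult.assoc)
qed

theorem lemma3p6:
  fixes k :: nat
  shows "\<exists>C :: nat. \<forall>(n :: nat) (L :: complex mat \<Rightarrow> complex mat) (chi :: pstring \<Rightarrow> pstring \<Rightarrow> complex)
      (lam :: real) (\<gamma> :: real) (\<epsilon>L :: real) (Lhat :: pstring \<Rightarrow> pstring \<Rightarrow> complex).
    let \<Omega>m = Omega n k chi (lam - \<gamma>);
        \<Omega>p = Omega n k chi (lam + \<gamma>);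
        Dm = (\<Sum>l=0..k. real (ddeg n \<Omega>m) ^ l);
        \<rho>p = rho n chi \<Omega>p
    in
      k_local_lindblad n k L \<longrightarrow> chi_coeffs n L chi \<longrightarrow>
      0 < lam \<longrightarrow> 0 < \<gamma> \<longrightarrow> \<gamma> < lam \<longrightarrow>
      (\<forall>S. S \<subseteq> {..<n} \<and> S \<noteq> {} \<and> card S \<le> k \<longrightarrow>
         (\<forall>A\<in>strings S. \<forall>B\<in>strings S. cmod (Lhat A B - ptm n L A B) \<le> \<epsilon>L)) \<longrightarrow>
      Dm * (\<epsilon>L + \<rho>p) \<le> \<gamma> \<longrightarrow>
      (\<forall>st. (\<exists>xs. visit_order n k xs \<and> st = guarded_recovery lam Lhat xs) \<or>
            st = result (exhaustive_recovery n k lam Lhat) \<longrightarrow>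
         \<Omega>p \<subseteq> accepted st \<and> accepted st \<subseteq> \<Omega>m \<and>
         (\<forall>(P, Q) \<in> local_pairs0 n k.
            (cmod (chi P Q) > lam + \<gamma> \<longrightarrow> (P, Q) \<in> accepted st) \<and>
            (cmod (chi P Q) \<le> lam - \<gamma> \<longrightarrow> (P, Q) \<notin> accepted st)) \<and>
         (\<forall>(P, Q) \<in> accepted st. cmod (estimate st (P, Q) - chi P Q) \<le> \<gamma>)) \<and>
      (n \<ge> 1 \<longrightarrow>
         (let T = cost (exhaustive_recovery n k lam Lhat);
              N = card (accepted (result (exhaustive_recovery n k lam Lhat)))
          in T \<le> C * (n ^ k + 2 ^ k * N) \<and>
             n ^ k + 2 ^ k * N \<le> C * n ^ k \<and>
             T \<le> C * n ^ k))"
proof -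
  \<comment> \<open>The first summand bounds the running time; the second bounds
    \<open>n ^ k + 2 ^ k * N\<close> through \<open>card_local_pairs\<close>.\<close>
  define C where "C = runtime_const k + (1 + 2 ^ k * (k * 16 ^ k))"
  show ?thesis
    unfolding Let_def
  proof (intro exI[of _ C] allI impI, intro conjI allI impI)
    fix n and L :: "complex mat \<Rightarrow> complex mat" and chi :: "pstring \<Rightarrow> pstring \<Rightarrow> complex"
      and lam \<gamma> \<epsilon>L :: real and Lhat :: "pstring \<Rightarrow> pstring \<Rightarrow> complex"
    let ?\<Omega>m = "Omega n k chi (lam - \<gamma>)" and ?\<Omega>p = "Omega n k chi (lam + \<gamma>)"
    let ?ex = "exhaustive_recovery n k lam Lhat"
    assume chi: "chi_coeffs n L chi"
      and close: "\<forall>S. S \<subseteq> {..<n} \<and> S \<noteq> {} \<and> card S \<le> k \<longrightarrow>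
         (\<forall>A\<in>strings S. \<forall>B\<in>strings S. cmod (Lhat A B - ptm n L A B) \<le> \<epsilon>L)"
      and margin: "(\<Sum>l=0..k. real (ddeg n ?\<Omega>m) ^ l) * (\<epsilon>L + rho n chi ?\<Omega>p) \<le> \<gamma>"
    note correct = recovery_correct[OF chi close margin]
    {
      fix st assume "(\<exists>xs. visit_order n k xs \<and> st = guarded_recovery lam Lhat xs) \<or> st = result ?ex"
      note st = correct[OF this]
      show "?\<Omega>p \<subseteq> accepted st" "accepted st \<subseteq> ?\<Omega>m" by (fact st)+
      then show "\<forall>(P, Q)\<in>local_pairs0 n k.
          (cmod (chi P Q) > lam + \<gamma> \<longrightarrow> (P, Q) \<in> accepted st) \<and>
          (cmod (chi P Q) \<le> lam - \<gamma> \<longrightarrow> (P, Q) \<notin> accepted st)"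
        by (fastforce simp: Omega_def)
      show "\<forall>(P, Q)\<in>accepted st. cmod (estimate st (P, Q) - chi P Q) \<le> \<gamma>" by (fact st)
    next
      assume n: "n \<ge> 1"
      let ?N = "card (accepted (result ?ex))"
      have "cost ?ex \<le> runtime_const k * n ^ k" by (rule cost_exhaustive_recovery[OF n])
      also have "\<dots> \<le> C * n ^ k" by (rule mult_right_mono) (simp_all add: C_def)
      finally show T: "cost ?ex \<le> C * n ^ k" .
      also have "\<dots> \<le> C * (n ^ k + 2 ^ k * ?N)" by (rule mult_left_mono) simp_all
      finally show "cost ?ex \<le> C * (n ^ k + 2 ^ k * ?N)" .
      have "accepted (result ?ex) \<subseteq> local_pairs0 n k"
        using correct(2)[of "result ?ex"] by (auto simp: Omega_def)
      then have "2 ^ k * ?N \<le> 2 ^ k * (k * 16 ^ k * n ^ k)"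
        by (intro mult_left_mono card_local_pairs n) simp_all
      then have "n ^ k + 2 ^ k * ?N \<le> (1 + 2 ^ k * (k * 16 ^ k)) * n ^ k"
        by (simp add: algebra_simps)
      also have "\<dots> \<le> C * n ^ k" by (rule mult_right_mono) (simp_all add: C_def)
      finally show "n ^ k + 2 ^ k * ?N \<le> C * n ^ k" .
    }
  qed
qed

end
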